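(* Let $m$ be a fixed constant. For inputs $(A,d,c,x^* )$ to WI-SP (see context) with $m$ constraints in which $x^*$ is an extreme point of $\{x\in[0,1]^n: Ax\le d\}$, a weight inequality, with respect to some row constraint of $Ax\le d$, that is violated by $x^*$ can be found in polynomial time, if one exists.
   Context: $\mathbb{Z}_+$ denotes the nonnegative integers. An input to WI-SP consists of $A\in\mathbb{Z}_+^{m\times n}$, $d\in\mathbb{Z}_+^m$, $c\in\mathbb{Z}_+^n$ and an optimal solution $x^*$ to the LP relaxation $\max\{c^{\mathsf T}x: Ax\le d,\ x\in[0,1]^n\}$. With respect to a row constraint $a^{\mathsf T}x\le b$ of $Ax\le d$: a pack is a set $P\subseteq\{1,\dots,n\}$ with $\sum_{i\in P}a_i\le b$; its residual capacity is $r(P):=b-\sum_{i\in P}a_i$; its weight inequality (WI) is $\sum_{i\in P}a_ix_i+\sum_{j\notin P}\max\{a_j-r(P),0\}x_j\le\sum_{i\in P}a_i$. "Violated by $x^*$" (separating) means that $x^*$ does not satisfy the inequality. *)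

theory Defs
  imports
    Complex_Main
    "HOL-Library.Log_Nat"
    "HOL-Computational_Algebra.Polynomial"
    "Jordan_Normal_Form.Matrix"
begin

section \<open>Polynomial time\<close>

text \<open>
  The machine model is a random access machine with logarithmic (bit) cost, presented as a
  structured while language.  A program uses finitely many named arrays of integers, each
  indexed by all integers.  Evaluating an expression costs the sum of the bit lengths of the
  values of all its nodes, the addresses of indirect memory accesses included.  Hence a number of
  \<open>l\<close> bits can only be written at cost at least \<open>l\<close>, and polynomial cost is the same as polynomial
  time on Turing machines.
\<close>

datatype aexp =
    N int
  | Cell string aexp
  | Add aexp aexp
  | Sub aexp aexp
  | Mul aexp aexp
  | Div aexp aexp

datatype bexp = Less aexp aexp | Neg bexp | Conj bexp bexp

datatype com =
    SKIP
  | Assign string aexp aexp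
  | Seq com com
  | Cond bexp com com
  | While bexp com

type_synonym state = "string \<Rightarrow> int \<Rightarrow> int"

text \<open>Number of binary digits, plus one for the sign.\<close>
definition bits :: "int \<Rightarrow> nat" where
  "bits z = Suc (floorlog 2 (nat \<bar>z\<bar>))"

definition list_bits :: "int list \<Rightarrow> nat" where
  "list_bits w = sum_list (map bits w)"

fun aval :: "aexp \<Rightarrow> state \<Rightarrow> int" where
  "aval (N z) s = z"
| "aval (Cell a e) s = s a (aval e s)"
| "aval (Add e f) s = aval e s + aval f s"
| "aval (Sub e f) s = aval e s - aval f s"
| "aval (Mul e f) s = aval e s * aval f s"
| "aval (Div e f) s = aval e s div aval f s"

fun acost :: "aexp \<Rightarrow> state \<Rightarrow> nat" where
  "acost (N z) s = bits z"
| "acost (Cell a e) s = acost e s + bits (aval (Cell a e) s)"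
| "acost (Add e f) s = acost e s + acost f s + bits (aval (Add e f) s)"
| "acost (Sub e f) s = acost e s + acost f s + bits (aval (Sub e f) s)"
| "acost (Mul e f) s = acost e s + acost f s + bits (aval (Mul e f) s)"
| "acost (Div e f) s = acost e s + acost f s + bits (aval (Div e f) s)"

fun bval :: "bexp \<Rightarrow> state \<Rightarrow> bool" where
  "bval (Less e f) s \<longleftrightarrow> aval e s < aval f s"
| "bval (Neg b) s \<longleftrightarrow> \<not> bval b s"
| "bval (Conj b c) s \<longleftrightarrow> bval b s \<and> bval c s"

fun bcost :: "bexp \<Rightarrow> state \<Rightarrow> nat" where
  "bcost (Less e f) s = Suc (acost e s + acost f s)"
| "bcost (Neg b) s = Suc (bcost b s)"
| "bcost (Conj b c) s = Suc (bcost b s + bcost c s)"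

text \<open>\<open>exec c s t s'\<close>: started in \<open>s\<close>, the program \<open>c\<close> halts in \<open>s'\<close> at cost \<open>t\<close>.\<close>
inductive exec :: "com \<Rightarrow> state \<Rightarrow> nat \<Rightarrow> state \<Rightarrow> bool" where
  Skip: "exec SKIP s 1 s"
| Assign: "exec (Assign a i e) s (Suc (acost i s + acost e s))
             (s(a := (s a)(aval i s := aval e s)))"
| Seq: "exec c s t s' \<Longrightarrow> exec d s' u s'' \<Longrightarrow> exec (Seq c d) s (Suc (t + u)) s''"
| CondTrue: "bval b s \<Longrightarrow> exec c s t s' \<Longrightarrow> exec (Cond b c d) s (Suc (bcost b s + t)) s'"
| CondFalse: "\<not> bval b s \<Longrightarrow> exec d s t s' \<Longrightarrow> exec (Cond b c d) s (Suc (bcost b s + t)) s'"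
| WhileFalse: "\<not> bval b s \<Longrightarrow> exec (While b c) s (Suc (bcost b s)) s"
| WhileTrue: "bval b s \<Longrightarrow> exec c s t s' \<Longrightarrow> exec (While b c) s' u s''
    \<Longrightarrow> exec (While b c) s (Suc (bcost b s + t + u)) s''"

inductive_cases exec_SkipE: "exec SKIP s t s'"
inductive_cases exec_AssignE: "exec (Assign a i e) s t s'"
inductive_cases exec_SeqE: "exec (Seq c d) s t s'"
inductive_cases exec_CondE: "exec (Cond b c d) s t s'"
inductive_cases exec_WhileE: "exec (While b c) s t s'"

lemma exec_deterministic:
  "exec c s t s' \<Longrightarrow> exec c s u s'' \<Longrightarrow> t = u \<and> s' = s''"
proof (induction arbitrary: u s'' rule: exec.induct)
  case Skip
  then show ?case by (auto elim: exec_SkipE)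
next
  case Assign
  then show ?case by (auto elim: exec_AssignE)
next
  case Seq
  from Seq.prems show ?case by (rule exec_SeqE) (use Seq.IH in blast)
next
  case CondTrue
  from CondTrue.prems show ?case by (rule exec_CondE) (use CondTrue in blast)+
next
  case CondFalse
  from CondFalse.prems show ?case by (rule exec_CondE) (use CondFalse in blast)+
next
  case WhileFalse
  from WhileFalse.prems show ?case by (rule exec_WhileE) (use WhileFalse in blast)+
next
  case WhileTrue
  from WhileTrue.prems show ?case by (rule exec_WhileE) (use WhileTrue in blast)+
qed

text \<open>Words are stored with their length in cell \<open>0\<close> and their entries in the cells from \<open>1\<close> on.\<close>
definition input_state :: "int list \<Rightarrow> state" where
  "input_state w = (\<lambda>a i.
     if a = ''in'' then
       if i = 0 then int (length w)
       else if 1 \<le> i \<and> i \<le> int (length w) then w ! nat (i - 1)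
       else 0
     else 0)"

definition output_word :: "state \<Rightarrow> int list" where
  "output_word s = map (s ''out'') [1..s ''out'' 0]"

text \<open>
  \<open>I\<close> is the set of admissible instances, \<open>enc\<close> their encoding, and \<open>sol x w\<close> says that the word
  \<open>w\<close> is a correct answer to the instance \<open>x\<close>.  One program and one polynomial must serve all
  instances.  The length of the answer is charged as well, because reading off the output involves
  cells that the program need not have written.
\<close>
definition poly_time_solvable ::
    "'a set \<Rightarrow> ('a \<Rightarrow> int list) \<Rightarrow> ('a \<Rightarrow> int list \<Rightarrow> bool) \<Rightarrow> bool" where
  "poly_time_solvable I enc sol \<longleftrightarrow>
     (\<exists>c (p :: nat poly). \<forall>x\<in>I. \<exists>t s.
        exec c (input_state (enc x)) t s \<and>
        t + list_bits (output_word s) \<le> poly p (list_bits (enc x)) \<and>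
        sol x (output_word s))"


section \<open>Weight inequalities\<close>

text \<open>Variables and rows are numbered from \<open>0\<close>.\<close>

definition is_pack :: "real vec \<Rightarrow> real \<Rightarrow> nat set \<Rightarrow> bool" where
  "is_pack a b P \<longleftrightarrow> P \<subseteq> {0..<dim_vec a} \<and> (\<Sum>i\<in>P. a $ i) \<le> b"

definition residual_capacity :: "real vec \<Rightarrow> real \<Rightarrow> nat set \<Rightarrow> real" where
  "residual_capacity a b P = b - (\<Sum>i\<in>P. a $ i)"

definition weight_inequality :: "real vec \<Rightarrow> real \<Rightarrow> nat set \<Rightarrow> real vec \<Rightarrow> bool" where
  "weight_inequality a b P x \<longleftrightarrow>
     (\<Sum>i\<in>P. a $ i * x $ i) +
     (\<Sum>j\<in>{0..<dim_vec a} - P. max (a $ j - residual_capacity a b P) 0 * x $ j)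
     \<le> (\<Sum>i\<in>P. a $ i)"


section \<open>The separation problem\<close>

definition lp_polytope :: "nat mat \<Rightarrow> nat vec \<Rightarrow> real vec set" where
  "lp_polytope A d =
     {y \<in> carrier_vec (dim_col A).
        (\<forall>j<dim_col A. 0 \<le> y $ j \<and> y $ j \<le> 1) \<and> map_mat real A *\<^sub>v y \<le> map_vec real d}"

definition lp_optimal :: "nat mat \<Rightarrow> nat vec \<Rightarrow> nat vec \<Rightarrow> real vec \<Rightarrow> bool" where
  "lp_optimal A d c x \<longleftrightarrow>
     x \<in> lp_polytope A d \<and>
     (\<forall>y\<in>lp_polytope A d. map_vec real c \<bullet> y \<le> map_vec real c \<bullet> x)"

text \<open>The notion \<open>extreme_point_of\<close> of \<open>HOL-Analysis\<close>, which is restricted to the class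
  \<open>real_vector\<close>, for vectors with an explicit dimension.\<close>
definition extreme_point :: "real vec \<Rightarrow> real vec set \<Rightarrow> bool" where
  "extreme_point x S \<longleftrightarrow>
     x \<in> S \<and>
     \<not> (\<exists>y\<in>S. \<exists>z\<in>S. \<exists>u. y \<noteq> z \<and> 0 < u \<and> u < 1 \<and> x = (1 - u) \<cdot>\<^sub>v y + u \<cdot>\<^sub>v z)"

type_synonym wi_sp = "nat mat \<times> nat vec \<times> nat vec \<times> rat vec"

text \<open>\<open>m\<close> is the number of constraints.\<close>
definition wi_sp_inputs :: "nat \<Rightarrow> wi_sp set" where
  "wi_sp_inputs m =
     {(A, d, c, x). \<exists>n. A \<in> carrier_mat m n \<and> d \<in> carrier_vec m \<and> c \<in> carrier_vec n \<and>
        x \<in> carrier_vec n \<and> lp_optimal A d c (map_vec of_rat x)}"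

fun encode_wi_sp :: "wi_sp \<Rightarrow> int list" where
  "encode_wi_sp (A, d, c, x) =
     [int (dim_row A), int (dim_col A)]
     @ map int (concat (mat_to_list A))
     @ map int (list_of_vec d)
     @ map int (list_of_vec c)
     @ concat (map (\<lambda>q. [fst (quotient_of q), snd (quotient_of q)]) (list_of_vec x))"

fun violated_wi :: "wi_sp \<Rightarrow> nat \<Rightarrow> nat set \<Rightarrow> bool" where
  "violated_wi (A, d, c, x) i P \<longleftrightarrow>
     i < dim_row A \<and>
     is_pack (map_vec real (row A i)) (real (d $ i)) P \<and>
     \<not> weight_inequality (map_vec real (row A i)) (real (d $ i)) P (map_vec of_rat x)"

text \<open>A weight inequality is returned as the index of its row followed by the incidence vector of
  its pack; the empty word reports that no weight inequality is violated.\<close>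
fun wi_sp_answer :: "wi_sp \<Rightarrow> int list \<Rightarrow> bool" where
  "wi_sp_answer (A, d, c, x) w \<longleftrightarrow>
     (if \<exists>i P. violated_wi (A, d, c, x) i P
      then \<exists>i P. violated_wi (A, d, c, x) i P \<and>
             w = int i # map (\<lambda>j. if j \<in> P then 1 else 0) [0..<dim_col A]
      else w = [])"

end

theory Submission
  imports Defs
begin

text \<open>
  Let \<open>r\<close> be the residual capacity of a pack \<open>P\<close> of the row \<open>a\<^sup>Tx \<le> b\<close>.  Because
  \<open>a\<^sub>j - max {a\<^sub>j - r, 0} = min {a\<^sub>j, r}\<close>, the weight inequality is violated iff
  the sum of \<open>min {a\<^sub>j, r} x\<^sub>j\<close> over \<open>j \<notin> P\<close> is less than \<open>r - (b - a\<^sup>Tx)\<close>.  In this form one sees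
  that violation survives when the variables at value 0 are removed from \<open>P\<close> and all variables at
  value 1 are added to \<open>P\<close>.  So it suffices to try the packs that consist of the variables at
  value 1 and a subset of the fractional ones.  An extreme point has at most \<open>m\<close> fractional
  variables, since otherwise a nonzero solution of \<open>Ay = 0\<close> supported on them gives a segment
  around it.  Hence at most \<open>m 2\<^sup>m\<close> pairs of a row and a pack have to be tested, which is done in
  integers after scaling \<open>x\<close> by the product of its denominators.
\<close>

section \<open>Bit lengths\<close>

text \<open>\<open>bits\<close> counts a sign digit besides the binary digits, hence the shift by
  one between the two sides.\<close>

lemma bits_le_iff: "bits z \<le> Suc k \<longleftrightarrow> \<bar>z\<bar> < 2 ^ k"
proof -
  have "nat \<bar>z\<bar> < 2 ^ k \<longleftrightarrow> \<bar>z\<bar> < 2 ^ k"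
    by (metis abs_ge_zero nat_less_iff of_nat_numeral of_nat_power)
  then show ?thesis
    by (simp add: bits_def floorlog_le_iff[of 2, simplified])
qed

lemma bits_ge_1: "1 \<le> bits z"
  by (simp add: bits_def)

lemma abs_less_bits: "\<bar>z\<bar> < 2 ^ (bits z - 1)"
  using bits_le_iff[of z "bits z - 1"] bits_ge_1[of z] by simp

lemma bits_leI:
  assumes "\<bar>z\<bar> < 2 ^ k" "k < b"
  shows "bits z \<le> b"
  using assms bits_le_iff[of z k] by simp

text \<open>The sum of the lengths is crude, but the same bound holds for differences and products,
  so one linear measure \<open>leaves\<close> can serve all operations. The doubling caused by the
  addition is paid for by the second sign digit.\<close>

lemma bits_add: "bits (a + b) \<le> bits a + bits b"
proof (rule bits_leI)
  let ?x = "bits a - 1" and ?y = "bits b - 1"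
  have "(2 :: int) ^ ?x \<le> 2 ^ (?x + ?y)" "(2 :: int) ^ ?y \<le> 2 ^ (?x + ?y)"
    by (auto intro: power_increasing)
  with abs_less_bits[of a] abs_less_bits[of b]
  show "\<bar>a + b\<bar> < 2 ^ Suc (?x + ?y)"
    unfolding power_Suc by linarith
  show "Suc (?x + ?y) < bits a + bits b"
    using bits_ge_1[of a] bits_ge_1[of b] by simp
qed

lemma bits_minus: "bits (- a) = bits a"
  by (simp add: bits_def)

lemma bits_diff: "bits (a - b) \<le> bits a + bits b"
  using bits_add[of a "- b"] by (simp add: bits_minus)

lemma bits_mult: "bits (a * b) \<le> bits a + bits b"
proof (rule bits_leI)
  let ?x = "bits a - 1" and ?y = "bits b - 1"
  show "\<bar>a * b\<bar> < 2 ^ (?x + ?y)"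
    unfolding abs_mult power_add
    using abs_less_bits[of a] abs_less_bits[of b] by (intro mult_strict_mono) auto
  show "?x + ?y < bits a + bits b"
    using bits_ge_1[of a] by simp
qed

text \<open>Division rounds down, and division by 0 yields 0. For a negative dividend rounding goes
  away from zero, but \<open>x * y \<le> x\<close> still gives \<open>x \<le> x div y\<close>. A
  negative divisor is handled by negating both arguments.\<close>

lemma abs_div_le: "\<bar>a div b\<bar> \<le> \<bar>a\<bar>" for a b :: int
proof (cases "b = 0")
  case False
  have *: "\<bar>x div y\<bar> \<le> \<bar>x\<bar>" if "y > 0" for x y :: int
  proof (cases "x \<ge> 0")
    case True
    then have "0 \<le> x div y" using that by (simp add: pos_imp_zdiv_nonneg_iff)
    moreover from this that have "x div y * 1 \<le> x div y * y" by (intro mult_left_mono) auto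
    moreover have "x div y * y \<le> x"
      using that div_mult_mod_eq[of x y] pos_mod_sign[of y x] by linarith
    ultimately show ?thesis using True by simp
  next
    case False
    have "x * y \<le> x * 1"
      using False that by (intro mult_left_mono_neg) auto
    then have "x \<le> x div y"
      using that zdiv_mono1[of "x * y" x y] by simp
    moreover have "x div y < 0"
      using False that by (simp add: div_neg_pos_less0)
    ultimately show ?thesis by simp
  qed
  show ?thesis
    using *[of b a] *[of "- b" "- a"] False by (cases "b > 0") auto
qed simp

lemma bits_mono: "\<bar>a\<bar> \<le> \<bar>b\<bar> \<Longrightarrow> bits a \<le> bits b"
  using abs_less_bits[of b] bits_leI[of a "bits b - 1" "bits b"] bits_ge_1[of b] by simp

lemma bits_div: "bits (a div b) \<le> bits a"
  by (intro bits_mono abs_div_le)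

section \<open>Syntactic bounds on bit lengths and running costs\<close>

fun leaves :: "aexp \<Rightarrow> nat" where
  "leaves (N z) = bits z"
| "leaves (Cell a e) = 1"
| "leaves (Add e f) = leaves e + leaves f"
| "leaves (Sub e f) = leaves e + leaves f"
| "leaves (Mul e f) = leaves e + leaves f"
| "leaves (Div e f) = leaves e + leaves f"

fun asize :: "aexp \<Rightarrow> nat" where
  "asize (N z) = bits z"
| "asize (Cell a e) = asize e + 1"
| "asize (Add e f) = asize e + asize f + (leaves e + leaves f)"
| "asize (Sub e f) = asize e + asize f + (leaves e + leaves f)"
| "asize (Mul e f) = asize e + asize f + (leaves e + leaves f)"
| "asize (Div e f) = asize e + asize f + (leaves e + leaves f)"

fun bsize :: "bexp \<Rightarrow> nat" where
  "bsize (Less e f) = Suc (asize e + asize f)"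
| "bsize (Neg b) = Suc (bsize b)"
| "bsize (Conj b c) = Suc (bsize b + bsize c)"

text \<open>A polynomial in the number of iterations of each loop. The factor
  \<open>[:1, 1:]\<close> pays for the iterations and the final failing test, and nested loops raise
  the degree. Branches are added since a maximum would not be a polynomial.\<close>

fun cost_poly :: "com \<Rightarrow> nat poly" where
  "cost_poly SKIP = 1"
| "cost_poly (Assign a i e) = [:Suc (asize i + asize e):]"
| "cost_poly (Seq c d) = 1 + cost_poly c + cost_poly d"
| "cost_poly (Cond b c d) = [:Suc (bsize b):] + cost_poly c + cost_poly d"
| "cost_poly (While b c) = [:1, 1:] * ([:Suc (bsize b):] + cost_poly c)"

definition small :: "nat \<Rightarrow> state \<Rightarrow> bool" where
  "small \<beta> s \<longleftrightarrow> (\<forall>a i. bits (s a i) \<le> \<beta>)"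

lemma small_pos: "small \<beta> s \<Longrightarrow> 1 \<le> \<beta>"
  unfolding small_def using bits_ge_1 order_trans by blast

text \<open>All four operations are subadditive in the bit length. A \<open>Cell\<close> counts as a
  single leaf whatever its address, because its content fits into \<open>\<beta>\<close>
  bits.\<close>

lemma bits_aval:
  assumes "small \<beta> s"
  shows "bits (aval e s) \<le> leaves e * \<beta>"
proof (induction e)
  case (N z)
  then show ?case using small_pos[OF assms] by simp
next
  case (Cell a e)
  then show ?case using assms by (simp add: small_def)
next
  case (Add e f)
  then show ?case using bits_add[of "aval e s" "aval f s"] by (simp add: algebra_simps)
next
  case (Sub e f)
  then show ?case using bits_diff[of "aval e s" "aval f s"] by (simp add: algebra_simps)
next
  case (Mul e f)
  then show ?case using bits_mult[of "aval e s" "aval f s"] by (simp add: algebra_simps)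
next
  case (Div e f)
  then show ?case using bits_div[of "aval e s" "aval f s"] by (simp add: algebra_simps)
qed

lemma acost_le:
  assumes "small \<beta> s"
  shows "acost e s \<le> asize e * \<beta>"
proof (induction e)
  case (N z)
  then show ?case using small_pos[OF assms] by simp
next
  case (Cell a e)
  then show ?case using bits_aval[OF assms, of "Cell a e"] by (simp add: algebra_simps)
next
  case (Add e f)
  then show ?case using bits_aval[OF assms, of "Add e f"] by (simp add: algebra_simps)
next
  case (Sub e f)
  then show ?case using bits_aval[OF assms, of "Sub e f"] by (simp add: algebra_simps)
next
  case (Mul e f)
  then show ?case using bits_aval[OF assms, of "Mul e f"] by (simp add: algebra_simps)
next
  case (Div e f)
  then show ?case using bits_aval[OF assms, of "Div e f"] by (simp add: algebra_simps)
qed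

lemma bcost_le:
  assumes "small \<beta> s"
  shows "bcost b s \<le> bsize b * \<beta>"
proof (induction b)
  case (Less e f)
  then show ?case
    using acost_le[OF assms, of e] acost_le[OF assms, of f] small_pos[OF assms]
    by (simp add: algebra_simps)
next
  case (Neg b)
  then show ?case using small_pos[OF assms] by (simp add: algebra_simps)
next
  case (Conj b c)
  then show ?case using small_pos[OF assms] by (simp add: algebra_simps)
qed

section \<open>Hoare triples with cost\<close>

text \<open>The cost bound of a triple charges \<open>n\<close> iterations to every loop and is scaled by \<open>\<beta>\<close>, the
  maximal bit length of a cell; every assignment is obliged to respect \<open>\<beta>\<close>.\<close>

definition triple :: "nat \<Rightarrow> nat \<Rightarrow> (state \<Rightarrow> bool) \<Rightarrow> com \<Rightarrow> (state \<Rightarrow> bool) \<Rightarrow> bool" where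
  "triple n \<beta> P c Q \<longleftrightarrow> (\<forall>s. P s \<longrightarrow> small \<beta> s \<longrightarrow>
     (\<exists>t s'. exec c s t s' \<and> t \<le> poly (cost_poly c) n * \<beta> \<and> small \<beta> s' \<and> Q s'))"

lemma tripleE:
  assumes "triple n \<beta> P c Q" "P s" "small \<beta> s"
  obtains t s' where "exec c s t s'" "t \<le> poly (cost_poly c) n * \<beta>" "small \<beta> s'" "Q s'"
  using assms unfolding triple_def by blast

lemma triple_conseq:
  assumes "triple n \<beta> P c Q" "\<And>s. P' s \<Longrightarrow> P s" "\<And>s. Q s \<Longrightarrow> Q' s"
  shows "triple n \<beta> P' c Q'"
  using assms unfolding triple_def by blast

lemma triple_Seq:
  assumes "triple n \<beta> P c Q" "triple n \<beta> Q d R"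
  shows "triple n \<beta> P (Seq c d) R"
  unfolding triple_def
proof (intro allI impI)
  fix s assume s: "P s" "small \<beta> s"
  obtain t s' where 1: "exec c s t s'" "t \<le> poly (cost_poly c) n * \<beta>" "small \<beta> s'" "Q s'"
    using tripleE[OF assms(1) s] .
  obtain u s'' where 2: "exec d s' u s''" "u \<le> poly (cost_poly d) n * \<beta>" "small \<beta> s''" "R s''"
    using tripleE[OF assms(2) 1(4,3)] .
  have "Suc (t + u) \<le> poly (cost_poly (Seq c d)) n * \<beta>"
    using 1(2) 2(2) small_pos[OF s(2)] by (simp add: algebra_simps)
  with exec.Seq[OF 1(1) 2(1)] 2(3,4)
  show "\<exists>t s'. exec (Seq c d) s t s' \<and> t \<le> poly (cost_poly (Seq c d)) n * \<beta> \<and> small \<beta> s' \<and> R s'"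
    by blast
qed

lemma triple_Cond:
  assumes "triple n \<beta> (\<lambda>s. P s \<and> bval b s) c Q" "triple n \<beta> (\<lambda>s. P s \<and> \<not> bval b s) d Q"
  shows "triple n \<beta> P (Cond b c d) Q"
  unfolding triple_def
proof (intro allI impI)
  fix s assume s: "P s" "small \<beta> s"
  have b: "Suc (bcost b s) \<le> Suc (bsize b) * \<beta>"
    using bcost_le[OF s(2), of b] small_pos[OF s(2)] by simp
  show "\<exists>t s'. exec (Cond b c d) s t s' \<and> t \<le> poly (cost_poly (Cond b c d)) n * \<beta> \<and>
      small \<beta> s' \<and> Q s'"
  proof (cases "bval b s")
    case True
    then obtain t s' where 1: "exec c s t s'" "t \<le> poly (cost_poly c) n * \<beta>" "small \<beta> s'" "Q s'"
      using tripleE[OF assms(1) _ s(2)] s by blast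
    have "Suc (bcost b s + t) \<le> poly (cost_poly (Cond b c d)) n * \<beta>"
      using 1(2) b by (simp add: algebra_simps)
    with exec.CondTrue[OF True 1(1)] 1(3,4) show ?thesis by blast
  next
    case False
    then obtain t s' where 1: "exec d s t s'" "t \<le> poly (cost_poly d) n * \<beta>" "small \<beta> s'" "Q s'"
      using tripleE[OF assms(2) _ s(2)] s by blast
    have "Suc (bcost b s + t) \<le> poly (cost_poly (Cond b c d)) n * \<beta>"
      using 1(2) b by (simp add: algebra_simps)
    with exec.CondFalse[OF False 1(1)] 1(3,4) show ?thesis by blast
  qed
qed

text \<open>The invariant is indexed by the number of completed iterations and determines the guard,
  so termination after exactly \<open>n\<close> rounds is built in.\<close>

lemma triple_While:
  assumes body: "\<And>j. j < n \<Longrightarrow> triple n \<beta> (I j) c (I (Suc j))"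
    and guard: "\<And>j s. I j s \<Longrightarrow> j \<le> n \<Longrightarrow> bval b s \<longleftrightarrow> j < n"
  shows "triple n \<beta> (I 0) (While b c) (I n)"
proof -
  define K where "K = (Suc (bsize b) + poly (cost_poly c) n) * \<beta>"
  \<comment> \<open>\<open>K\<close> bounds one round with its test. The \<open>Suc\<close> covers
    the last test, which fails.\<close>
  have *: "\<exists>t s'. exec (While b c) s t s' \<and> t \<le> Suc (n - j) * K \<and> small \<beta> s' \<and> I n s'"
    if "j \<le> n" "I j s" "small \<beta> s" for j s
    using that
  proof (induction "n - j" arbitrary: j s)
    case 0
    then have F: "\<not> bval b s" using guard by simp
    have "Suc (bcost b s) \<le> K"
      using bcost_le[OF 0(4), of b] small_pos[OF 0(4)] by (simp add: K_def algebra_simps)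
    with exec.WhileFalse[OF F] 0 show ?case by fastforce
  next
    case (Suc k)
    then have T: "bval b s" and j: "j < n" using guard by auto
    obtain t s' where 1: "exec c s t s'" "t \<le> poly (cost_poly c) n * \<beta>" "small \<beta> s'" "I (Suc j) s'"
      using tripleE[OF body[OF j] Suc.prems(2,3)] .
    obtain u s'' where 2: "exec (While b c) s' u s''" "u \<le> Suc (n - Suc j) * K"
        "small \<beta> s''" "I n s''"
      using Suc.hyps(1)[of "Suc j" s'] Suc.hyps(2) j 1(3,4) by force
    have "Suc (bcost b s + t) \<le> K"
      using bcost_le[OF Suc.prems(3), of b] small_pos[OF Suc.prems(3)] 1(2)
      by (simp add: K_def algebra_simps)
    moreover have "Suc (n - j) = Suc (Suc (n - Suc j))" using j by simp
    ultimately have "Suc (bcost b s + t + u) \<le> Suc (n - j) * K"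
      using 2(2) by simp
    with exec.WhileTrue[OF T 1(1) 2(1)] 2(3,4) show ?case by blast
  qed
  show ?thesis
    unfolding triple_def
  proof (intro allI impI)
    fix s assume "I 0 s" "small \<beta> s"
    then show "\<exists>t s'. exec (While b c) s t s' \<and> t \<le> poly (cost_poly (While b c)) n * \<beta> \<and>
        small \<beta> s' \<and> I n s'"
      using *[of 0 s] by (simp add: K_def algebra_simps)
  qed
qed

text \<open>Weakest preconditions of loop-free code, strengthened by the obligation that assigned
  values fit into \<open>\<beta>\<close> bits. Loops get \<open>False\<close> here and are treated
  by \<open>triple_While\<close>.\<close>

fun wp :: "nat \<Rightarrow> com \<Rightarrow> (state \<Rightarrow> bool) \<Rightarrow> state \<Rightarrow> bool" where
  "wp \<beta> SKIP Q s \<longleftrightarrow> Q s"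
| "wp \<beta> (Assign a i e) Q s \<longleftrightarrow> bits (aval e s) \<le> \<beta> \<and> Q (s(a := (s a)(aval i s := aval e s)))"
| "wp \<beta> (Seq c d) Q s \<longleftrightarrow> wp \<beta> c (wp \<beta> d Q) s"
| "wp \<beta> (Cond b c d) Q s \<longleftrightarrow> (if bval b s then wp \<beta> c Q s else wp \<beta> d Q s)"
| "wp \<beta> (While b c) Q s \<longleftrightarrow> False"

lemma triple_wp: "triple n \<beta> (wp \<beta> c Q) c Q"
proof (induction c arbitrary: Q)
  case SKIP
  show ?case unfolding triple_def using exec.Skip small_pos by fastforce
next
  case (Assign a i e)
  show ?case
    unfolding triple_def
  proof (intro allI impI)
    fix s assume wp: "wp \<beta> (Assign a i e) Q s" and s: "small \<beta> s"
    have "Suc (acost i s + acost e s) \<le> poly (cost_poly (Assign a i e)) n * \<beta>"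
      using acost_le[OF s, of i] acost_le[OF s, of e] small_pos[OF s]
      by (simp add: algebra_simps)
    moreover have "small \<beta> (s(a := (s a)(aval i s := aval e s)))"
      using wp s by (simp add: small_def)
    ultimately show "\<exists>t s'. exec (Assign a i e) s t s' \<and>
        t \<le> poly (cost_poly (Assign a i e)) n * \<beta> \<and> small \<beta> s' \<and> Q s'"
      using wp exec.Assign by fastforce
  qed
next
  case (Seq c d)
  show ?case
    by (rule triple_conseq[OF triple_Seq[OF Seq(1)[of "wp \<beta> d Q"] Seq(2)[of Q]]]) auto
next
  case (Cond b c d)
  show ?case
    by (rule triple_Cond; rule triple_conseq, rule Cond) auto
next
  case (While b c)
  show ?case by (simp add: triple_def)
qed

lemma triple_loop_free: "(\<And>s. P s \<Longrightarrow> wp \<beta> c Q s) \<Longrightarrow> triple n \<beta> P c Q"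
  using triple_conseq[OF triple_wp] .


section \<open>The separation program\<close>

abbreviation var :: "string \<Rightarrow> aexp" where
  "var v \<equiv> Cell v (N 0)"

abbreviation set_var :: "string \<Rightarrow> aexp \<Rightarrow> com" where
  "set_var v \<equiv> Assign v (N 0)"

text \<open>Layout of the array \<open>''in''\<close>: cell 0 holds the length, cells 1 and 2 hold
  \<open>m\<close> and \<open>n\<close>, the matrix starts at 3 row by row, and then come
  \<open>d\<close>, \<open>c\<close> and the pairs of numerator and denominator of \<open>x\<close>.
  Since \<open>m\<close> is fixed, it enters the addresses as a constant.\<close>

definition dim_exp :: aexp where
  "dim_exp = Cell ''in'' (N 2)"

definition coeff_exp :: "nat \<Rightarrow> aexp" where
  "coeff_exp i = Cell ''in'' (Add (Add (N 3) (Mul (N (int i)) dim_exp)) (var ''j''))"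

definition bound_exp :: "nat \<Rightarrow> nat \<Rightarrow> aexp" where
  "bound_exp m i = Cell ''in'' (Add (N (3 + int i)) (Mul (N (int m)) dim_exp))"

definition numerator_exp :: "nat \<Rightarrow> aexp" where
  "numerator_exp m =
     Cell ''in'' (Add (Add (N (3 + int m)) (Mul (N (int m + 1)) dim_exp)) (Mul (N 2) (var ''j'')))"

definition denominator_exp :: "nat \<Rightarrow> aexp" where
  "denominator_exp m =
     Cell ''in'' (Add (Add (N (4 + int m)) (Mul (N (int m + 1)) dim_exp)) (Mul (N 2) (var ''j'')))"

definition member_exp :: aexp where
  "member_exp = Cell ''out'' (Add (N 2) (var ''j''))"

definition scaled_exp :: "nat \<Rightarrow> aexp" where
  "scaled_exp m = Mul (numerator_exp m) (Div (var ''D'') (denominator_exp m))"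

definition for_each :: "com \<Rightarrow> com" where
  "for_each c = Seq (set_var ''j'' (N 0))
     (While (Less (var ''j'') dim_exp) (Seq c (set_var ''j'' (Add (var ''j'') (N 1)))))"

definition init :: "nat \<Rightarrow> com" where
  "init m = Seq (set_var ''D'' (N 1))
     (for_each (set_var ''D'' (Mul (var ''D'') (denominator_exp m))))"

definition set_member :: "aexp \<Rightarrow> com" where
  "set_member e = Assign ''out'' (Add (N 2) (var ''j'')) e"

text \<open>Decides the membership of variable \<open>j\<close>: value 1 puts it into the pack,
  value 0 keeps it out, and a fractional variable consumes the lowest bit of \<open>k\<close>,
  computed as the remainder \<open>k - 2 * (k div 2)\<close>. The weight of the pack is collected in
  \<open>w\<close>.\<close>

definition build :: "nat \<Rightarrow> nat \<Rightarrow> com" where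
  "build m i = Seq
     (Cond (Less (numerator_exp m) (denominator_exp m))
       (Cond (Less (N 0) (numerator_exp m))
         (Seq (set_member (Sub (var ''k'') (Mul (N 2) (Div (var ''k'') (N 2)))))
              (set_var ''k'' (Div (var ''k'') (N 2))))
         (set_member (N 0)))
       (set_member (N 1)))
     (set_var ''w'' (Add (var ''w'') (Mul (coeff_exp i) member_exp)))"

definition add_term :: "nat \<Rightarrow> nat \<Rightarrow> com" where
  "add_term m i = Cond (Less (N 0) member_exp)
     (set_var ''e'' (Add (var ''e'') (Mul (coeff_exp i) (scaled_exp m))))
     (Cond (Less (var ''r'') (coeff_exp i))
       (set_var ''e'' (Add (var ''e'') (Mul (Sub (coeff_exp i) (var ''r'')) (scaled_exp m))))
       SKIP)"

text \<open>\<open>e\<close> starts at the negated right-hand side scaled by \<open>D\<close>, so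
  that \<open>e > 0\<close> after the second loop means violation, while \<open>r \<ge> 0\<close>
  means that the set is a pack. The membership bits already lie in their output cells, so a hit only
  has to write the row and the length.\<close>

definition check :: "nat \<Rightarrow> nat \<Rightarrow> nat \<Rightarrow> com" where
  "check m i k =
     Seq (Seq (set_var ''k'' (N (int k))) (set_var ''w'' (N 0)))
    (Seq (for_each (build m i))
    (Seq (Seq (set_var ''r'' (Sub (bound_exp m i) (var ''w'')))
              (set_var ''e'' (Sub (N 0) (Mul (var ''w'') (var ''D'')))))
    (Seq (for_each (add_term m i))
      (Cond (Conj (Neg (Less (var ''r'') (N 0))) (Less (N 0) (var ''e'')))
        (Seq (Assign ''out'' (N 1) (N (int i))) (Assign ''out'' (N 0) (Add dim_exp (N 1))))
        SKIP))))"

fun check_all :: "nat \<Rightarrow> (nat \<times> nat) list \<Rightarrow> com" where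
  "check_all m [] = SKIP"
| "check_all m ((i, k) # xs) =
     Seq (Cond (Less (var ''out'') (N 1)) (check m i k) SKIP) (check_all m xs)"

text \<open>Since \<open>m\<close> is fixed, the search over rows and subsets of the fractional variables is unrolled;
  only the loops over the \<open>n\<close> variables remain.\<close>

definition separate :: "nat \<Rightarrow> com" where
  "separate m = Seq (init m) (check_all m (List.product [0..<m] [0..<2 ^ m]))"

section \<open>Correctness and cost of the program\<close>

text \<open>What the program sees of an instance, in integers. \<open>M\<close> bounds the entries,
  the dimensions, the masks and the common denominator, so that every assigned value is at most
  \<open>M ^ 6\<close> in absolute value; \<open>4 \<le> M\<close> absorbs small constant
  factors.\<close>

locale wi_data =
  fixes m n :: nat and inp :: "int \<Rightarrow> int" and a :: "nat \<Rightarrow> nat \<Rightarrow> int" and d p q :: "nat \<Rightarrow> int"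
    and M :: int and \<beta> :: nat
  assumes inp_dim: "inp 2 = int n"
    and inp_coeff: "\<And>i j. i < m \<Longrightarrow> j < n \<Longrightarrow> inp (3 + int i * int n + int j) = a i j"
    and inp_bound: "\<And>i. i < m \<Longrightarrow> inp (3 + int i + int m * int n) = d i"
    and inp_numerator: "\<And>j. j < n \<Longrightarrow> inp (3 + int m + (int m + 1) * int n + 2 * int j) = p j"
    and inp_denominator: "\<And>j. j < n \<Longrightarrow> inp (4 + int m + (int m + 1) * int n + 2 * int j) = q j"
    and coeff: "\<And>i j. i < m \<Longrightarrow> j < n \<Longrightarrow> 0 \<le> a i j" "\<And>i j. i < m \<Longrightarrow> j < n \<Longrightarrow> a i j \<le> M"
    and bound: "\<And>i. i < m \<Longrightarrow> 0 \<le> d i" "\<And>i. i < m \<Longrightarrow> d i \<le> M"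
    and quotient: "\<And>j. j < n \<Longrightarrow> 0 \<le> p j" "\<And>j. j < n \<Longrightarrow> p j \<le> q j" "\<And>j. j < n \<Longrightarrow> 0 < q j"
    and denominators: "(\<Prod>j<n. q j) \<le> M"
    and M: "int n + 1 \<le> M" "int m \<le> M" "2 ^ m \<le> M" "4 \<le> M"
    and \<beta>: "\<And>z. \<bar>z\<bar> \<le> M ^ 6 \<Longrightarrow> bits z \<le> \<beta>"
begin

section \<open>The mathematical values that the program computes\<close>

definition D :: int where "D = (\<Prod>j<n. q j)"

definition X :: "nat \<Rightarrow> int" where "X j = p j * (D div q j)"

definition frac :: "nat \<Rightarrow> bool" where "frac j \<longleftrightarrow> 0 < p j \<and> p j < q j"

definition rank :: "nat \<Rightarrow> nat" where "rank j = card {l. l < j \<and> frac l}"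

text \<open>Bit \<open>t\<close> of the mask \<open>k\<close> decides about the \<open>t\<close>-th fractional variable.\<close>

definition cand :: "nat \<Rightarrow> nat set" where
  "cand k = {j. j < n \<and> (p j = q j \<or> frac j \<and> odd (k div 2 ^ rank j))}"

definition weight :: "nat \<Rightarrow> nat \<Rightarrow> int" where
  "weight i k = (\<Sum>l<n. a i l * of_bool (l \<in> cand k))"

definition res :: "nat \<Rightarrow> nat \<Rightarrow> int" where "res i k = d i - weight i k"

text \<open>\<open>D\<close> times the contribution of variable \<open>l\<close> to the left side of
  the weight inequality; the test replaces the maximum with 0.\<close>

definition gain :: "nat \<Rightarrow> nat \<Rightarrow> nat \<Rightarrow> int" where
  "gain i k l = (if l \<in> cand k then a i l * X l
     else if res i k < a i l then (a i l - res i k) * X l else 0)"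

definition excess :: "nat \<Rightarrow> nat \<Rightarrow> int" where
  "excess i k = (\<Sum>l<n. gain i k l) - weight i k * D"

definition hit :: "nat \<Rightarrow> nat \<Rightarrow> bool" where
  "hit i k \<longleftrightarrow> 0 \<le> res i k \<and> 0 < excess i k"

section \<open>Size bounds for all intermediate values\<close>

lemma M_power: "i \<le> j \<Longrightarrow> M ^ i \<le> M ^ j"
  using M by (intro power_increasing) auto

lemma bits_M:
  assumes "\<bar>z\<bar> \<le> M ^ i" "i \<le> 6"
  shows "bits z \<le> \<beta>"
  using assms M_power[of i 6] \<beta> by (meson order_trans)

lemma bits_M1: "\<bar>z\<bar> \<le> M \<Longrightarrow> bits z \<le> \<beta>"
  using bits_M[of z 1] by simp

lemma D_pos: "0 < D" and D_le: "D \<le> M"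
  using quotient denominators by (auto simp: D_def intro: prod_pos)

text \<open>Denominators are positive integers, so omitting factors cannot enlarge the
  product.\<close>

lemma partial_prod:
  assumes "j \<le> n"
  shows "\<bar>\<Prod>l<j. q l\<bar> \<le> M"
proof -
  have ge: "1 \<le> q l" if "l < n" for l
    using quotient(3)[OF that] by simp
  have nn: "0 \<le> q l" if "l < j" for l
    using ge[of l] that assms by simp
  have "(\<Prod>l<j. q l) \<le> (\<Prod>l<n. q l)"
    using assms ge nn by (intro prod_mono2) auto
  moreover have "0 \<le> (\<Prod>l<j. q l)"
    using nn by (intro prod_nonneg) auto
  ultimately show ?thesis using denominators by simp
qed

lemma X_bounds:
  assumes "j < n"
  shows "0 \<le> X j" "X j \<le> M"
proof -
  have "0 \<le> D div q j"
    using D_pos quotient(3)[OF assms] by (simp add: pos_imp_zdiv_nonneg_iff)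
  moreover have "q j * (D div q j) \<le> D"
    using mult_div_mod_eq[of "q j" D] pos_mod_sign[OF quotient(3)[OF assms], of D] by linarith
  moreover have "p j * (D div q j) \<le> q j * (D div q j)"
    using calculation(1) quotient(2)[OF assms] by (intro mult_right_mono) auto
  ultimately show "0 \<le> X j" "X j \<le> M"
    using quotient(1)[OF assms] D_le by (auto simp: X_def)
qed

text \<open>Prefix sums are bounded, not only the total, because the loop stores each of them. At
  most \<open>n \<le> M\<close> terms of size at most \<open>M\<close> occur.\<close>

lemma partial_weight:
  assumes "i < m" "j \<le> n"
  shows "0 \<le> (\<Sum>l<j. a i l * of_bool (l \<in> cand k))" "(\<Sum>l<j. a i l * of_bool (l \<in> cand k)) \<le> M ^ 2"
proof -
  show "0 \<le> (\<Sum>l<j. a i l * of_bool (l \<in> cand k))"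
    using assms coeff by (intro sum_nonneg) auto
  have "(\<Sum>l<j. a i l * of_bool (l \<in> cand k)) \<le> (\<Sum>l<j. M)"
    using assms coeff M by (intro sum_mono) auto
  also have "\<dots> = int j * M" by simp
  also have "\<dots> \<le> M * M"
    using assms M by (intro mult_right_mono) auto
  finally show "(\<Sum>l<j. a i l * of_bool (l \<in> cand k)) \<le> M ^ 2"
    by (simp add: power2_eq_square)
qed

lemma weight_bounds: "i < m \<Longrightarrow> 0 \<le> weight i k \<and> weight i k \<le> M ^ 2"
  using partial_weight[of i n k] by (simp add: weight_def)

lemma res_bound:
  assumes "i < m"
  shows "\<bar>res i k\<bar> \<le> M ^ 2"
  using weight_bounds[OF assms, of k] bound[OF assms] M_power[of 1 2]
  unfolding res_def abs_le_iff by simp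

lemma gain_bounds:
  assumes "i < m" "l < n"
  shows "0 \<le> gain i k l" "gain i k l \<le> M ^ 4"
proof -
  have *: "0 \<le> c * X l \<and> c * X l \<le> M ^ 4" if "0 \<le> c" "c \<le> M ^ 3" for c
  proof -
    have "c * X l \<le> M ^ 3 * M"
      using that X_bounds[OF assms(2)] M by (intro mult_mono) auto
    then show ?thesis using that X_bounds[OF assms(2)] by (simp add: power_numeral_reduce mult_ac)
  qed
  have "M ^ 1 \<le> M ^ 2" by (rule M_power) simp
  \<comment> \<open>A candidate need not be a pack, so its residual can be as low as
    \<open>- (M ^ 2)\<close> and \<open>a i l - res i k\<close> can exceed \<open>M ^ 2\<close>; the
    factor 4 makes room for this below \<open>M ^ 3\<close>.\<close>
  moreover have "4 * M ^ 2 \<le> M * M ^ 2" using M by (intro mult_right_mono) auto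
  ultimately have "a i l \<le> M ^ 3" "a i l - res i k \<le> M ^ 3"
    using res_bound[OF assms(1), of k] coeff(2)[OF assms]
    by (simp_all add: power_numeral_reduce)
  then show "0 \<le> gain i k l" "gain i k l \<le> M ^ 4"
    using *[of "a i l"] *[of "a i l - res i k"] coeff(1)[OF assms] M by (auto simp: gain_def)
qed

lemma partial_excess:
  assumes "i < m" "j \<le> n"
  shows "\<bar>(\<Sum>l<j. gain i k l) - weight i k * D\<bar> \<le> M ^ 6"
proof -
  have "0 \<le> (\<Sum>l<j. gain i k l)"
    using assms gain_bounds by (intro sum_nonneg) auto
  moreover have "(\<Sum>l<j. gain i k l) \<le> (\<Sum>l<j. M ^ 4)"
    using assms gain_bounds by (intro sum_mono) auto
  moreover have "(\<Sum>l<j. M ^ 4) = int j * M ^ 4" by simp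
  moreover have "int j * M ^ 4 \<le> M * M ^ 4"
    using assms M by (intro mult_right_mono) auto
  moreover have "0 \<le> weight i k * D" "weight i k * D \<le> M ^ 2 * M"
    using weight_bounds[OF assms(1), of k] D_pos D_le M by (auto intro: mult_mono)
  moreover have "M ^ 3 \<le> M ^ 6" "M ^ 5 \<le> M ^ 6" by (rule M_power; simp)+
  ultimately show ?thesis by (simp add: power_numeral_reduce)
qed

lemma rank_Suc: "rank (Suc j) = rank j + of_bool (frac j)"
proof -
  have "{l. l < Suc j \<and> frac l} = (if frac j then insert j else id) {l. l < j \<and> frac l}"
    by (auto simp: less_Suc_eq)
  then show ?thesis by (simp add: rank_def)
qed

section \<open>Invariants and triples for the pieces of the program\<close>

definition prepared :: "state \<Rightarrow> bool" where
  "prepared s \<longleftrightarrow> s ''in'' = inp \<and> s ''D'' 0 = D"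

text \<open>The second condition on \<open>I\<close> says that the invariant ignores the counter, so
  setting and incrementing \<open>''j''\<close> preserve it. The body must leave the counter
  unchanged.\<close>

lemma triple_for_each:
  assumes body: "\<And>j. j < n \<Longrightarrow>
      triple n \<beta> (\<lambda>s. I j s \<and> s ''j'' 0 = int j) c (\<lambda>s. I (Suc j) s \<and> s ''j'' 0 = int j)"
    and I: "\<And>j s. I j s \<Longrightarrow> s ''in'' = inp" "\<And>j s u. I j s \<Longrightarrow> I j (s(''j'' := u))"
  shows "triple n \<beta> (I 0) (for_each c) (I n)"
  unfolding for_each_def
proof (rule triple_Seq)
  let ?J = "\<lambda>j s. I j s \<and> s ''j'' 0 = int j"
  show "triple n \<beta> (I 0) (set_var ''j'' (N 0)) (?J 0)"
    using I(2) by (intro triple_loop_free) (use M in \<open>auto intro!: bits_M1\<close>)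
  have "triple n \<beta> (?J 0) (While (Less (var ''j'') dim_exp)
      (Seq c (set_var ''j'' (Add (var ''j'') (N 1))))) (?J n)"
  proof (rule triple_While)
    fix j assume j: "j < n"
    show "triple n \<beta> (?J j) (Seq c (set_var ''j'' (Add (var ''j'') (N 1)))) (?J (Suc j))"
    proof (rule triple_Seq[OF body[OF j] triple_loop_free])
      fix s assume "I (Suc j) s \<and> s ''j'' 0 = int j"
      then show "wp \<beta> (set_var ''j'' (Add (var ''j'') (N 1))) (?J (Suc j)) s"
        using I(2) j M by (auto intro!: bits_M1)
    qed
  next
    fix j s assume "?J j s" "j \<le> n"
    then show "bval (Less (var ''j'') dim_exp) s \<longleftrightarrow> j < n"
      using I(1)[of j s] inp_dim by (simp add: dim_exp_def)
  qed
  then show "triple n \<beta> (?J 0) (While (Less (var ''j'') dim_exp)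
      (Seq c (set_var ''j'' (Add (var ''j'') (N 1))))) (I n)"
    by (rule triple_conseq) auto
qed

lemma triple_init:
  "triple n \<beta> (\<lambda>s. s ''in'' = inp \<and> s ''out'' 0 = 0) (init m) (\<lambda>s. prepared s \<and> s ''out'' 0 = 0)"
  unfolding init_def
proof (rule triple_Seq)
  let ?I = "\<lambda>j s. s ''in'' = inp \<and> s ''out'' 0 = 0 \<and> s ''D'' 0 = (\<Prod>l<j. q l)"
  show "triple n \<beta> (\<lambda>s. s ''in'' = inp \<and> s ''out'' 0 = 0) (set_var ''D'' (N 1)) (?I 0)"
    by (intro triple_loop_free) (use M in \<open>auto intro!: bits_M1\<close>)
  have "triple n \<beta> (?I 0) (for_each (set_var ''D'' (Mul (var ''D'') (denominator_exp m)))) (?I n)"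
  proof (rule triple_for_each[OF triple_loop_free])
    fix j s assume j: "j < n" and s: "?I j s \<and> s ''j'' 0 = int j"
    show "wp \<beta> (set_var ''D'' (Mul (var ''D'') (denominator_exp m)))
        (\<lambda>s. ?I (Suc j) s \<and> s ''j'' 0 = int j) s"
      using s j inp_denominator[OF j] inp_dim partial_prod[of "Suc j"]
      by (simp add: denominator_exp_def dim_exp_def bits_M1 lessThan_Suc mult_ac)
  qed auto
  then show "triple n \<beta> (?I 0) (for_each (set_var ''D'' (Mul (var ''D'') (denominator_exp m))))
      (\<lambda>s. prepared s \<and> s ''out'' 0 = 0)"
    by (rule triple_conseq) (auto simp: prepared_def D_def)
qed

text \<open>One bit has been shifted out for each fractional variable before \<open>j\<close>, which
  leaves \<open>k div 2 ^ rank j\<close> of the mask.\<close>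

definition built :: "nat \<Rightarrow> nat \<Rightarrow> nat \<Rightarrow> state \<Rightarrow> bool" where
  "built i k j s \<longleftrightarrow> prepared s \<and> s ''out'' 0 = 0 \<and> s ''k'' 0 = int (k div 2 ^ rank j) \<and>
     s ''w'' 0 = (\<Sum>l<j. a i l * of_bool (l \<in> cand k)) \<and>
     (\<forall>l<j. s ''out'' (2 + int l) = of_bool (l \<in> cand k))"

lemma triple_build:
  assumes "i < m" "k < 2 ^ m" "j < n"
  shows "triple n \<beta> (\<lambda>s. built i k j s \<and> s ''j'' 0 = int j) (build m i)
    (\<lambda>s. built i k (Suc j) s \<and> s ''j'' 0 = int j)"
proof (rule triple_loop_free)
  fix s assume s: "built i k j s \<and> s ''j'' 0 = int j"
  let ?k = "k div 2 ^ rank j"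
  have reads: "aval (numerator_exp m) s = p j" "aval (denominator_exp m) s = q j"
    using s inp_numerator inp_denominator inp_dim assms
    by (simp_all add: numerator_exp_def denominator_exp_def dim_exp_def built_def prepared_def)
  have "int k < 2 ^ m" using assms(2) by (metis of_nat_less_iff of_nat_numeral of_nat_power)
  then have k: "int k' \<le> M" if "k' \<le> k" for k'
    using M(3) that by linarith
  have kb: "bits (int (?k div 2)) \<le> \<beta>"
    by (intro bits_M1) (use k[of "?k div 2"] in \<open>simp add: div_le_dividend order_trans[OF div_le_dividend div_le_dividend]\<close>)
  have b01: "bits 0 \<le> \<beta>" "bits 1 \<le> \<beta>"
    using M by (auto intro!: bits_M1)
  have digit: "int ?k - 2 * (int ?k div 2) = of_bool (odd ?k)"
    by (simp add: minus_mult_div_eq_mod mod_2_eq_odd)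
  have w: "bits ((\<Sum>l<j. a i l * of_bool (l \<in> cand k)) + a i j * of_bool (j \<in> cand k)) \<le> \<beta>"
    using partial_weight[of i "Suc j" k] assms by (intro bits_M[of _ 2]) auto
  have half: "k div 2 ^ Suc (rank j) = ?k div 2"
    by (simp only: power_Suc2 div_mult2_eq)
  show "wp \<beta> (build m i) (\<lambda>s. built i k (Suc j) s \<and> s ''j'' 0 = int j) s"
  proof -
    note defs = build_def set_member_def built_def prepared_def coeff_exp_def member_exp_def dim_exp_def
    consider (one) "p j = q j" | (frac) "frac j" | (zero) "p j = 0" "p j \<noteq> q j"
      using quotient[OF assms(3)] by (fastforce simp: frac_def)
    then show ?thesis
    proof cases
      case one
      then have "j \<in> cand k" "\<not> frac j" using assms(3) by (auto simp: cand_def frac_def)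
      then show ?thesis
        using s one w b01 inp_dim inp_coeff[OF assms(1,3)]
        by (simp add: defs reads rank_Suc less_Suc_eq lessThan_Suc add.commute all_conj_distrib)
    next
      case frac
      then have "j \<in> cand k \<longleftrightarrow> odd ?k" "0 < p j" "p j < q j"
        using assms(3) by (auto simp: cand_def frac_def)
      then show ?thesis
        using s frac w b01 kb digit half inp_dim inp_coeff[OF assms(1,3)]
        by (simp add: defs reads rank_Suc less_Suc_eq lessThan_Suc add.commute all_conj_distrib zdiv_int)
    next
      case zero
      then have "j \<notin> cand k" "\<not> frac j" "0 < q j"
        using quotient[OF assms(3)] by (auto simp: cand_def frac_def)
      then show ?thesis
        using s zero w b01 inp_dim inp_coeff[OF assms(1,3)]
        by (simp add: defs reads rank_Suc less_Suc_eq lessThan_Suc add.commute all_conj_distrib)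
    qed
  qed
qed

definition summed :: "nat \<Rightarrow> nat \<Rightarrow> nat \<Rightarrow> state \<Rightarrow> bool" where
  "summed i k j s \<longleftrightarrow> prepared s \<and> s ''out'' 0 = 0 \<and> s ''r'' 0 = res i k \<and>
     s ''e'' 0 = (\<Sum>l<j. gain i k l) - weight i k * D \<and>
     (\<forall>l<n. s ''out'' (2 + int l) = of_bool (l \<in> cand k))"

lemma triple_add_term:
  assumes "i < m" "j < n"
  shows "triple n \<beta> (\<lambda>s. summed i k j s \<and> s ''j'' 0 = int j) (add_term m i)
    (\<lambda>s. summed i k (Suc j) s \<and> s ''j'' 0 = int j)"
proof (rule triple_loop_free)
  fix s assume s: "summed i k j s \<and> s ''j'' 0 = int j"
  have "aval (numerator_exp m) s = p j" "aval (denominator_exp m) s = q j"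
    "aval (coeff_exp i) s = a i j"
    using s inp_numerator inp_denominator inp_coeff inp_dim assms
    by (simp_all add: numerator_exp_def denominator_exp_def coeff_exp_def dim_exp_def
        summed_def prepared_def)
  then have reads: "aval (scaled_exp m) s = X j" "aval (coeff_exp i) s = a i j"
    "aval member_exp s = of_bool (j \<in> cand k)"
    using s assms by (simp_all add: scaled_exp_def member_exp_def X_def summed_def prepared_def)
  define E where "E = (\<Sum>l<j. gain i k l) - weight i k * D"
  have step: "(\<Sum>l<Suc j. gain i k l) - weight i k * D = E + gain i k j"
    by (simp add: E_def)
  have "bits (E + gain i k j) \<le> \<beta>"
    using partial_excess[of i "Suc j" k] assms unfolding step[symmetric] by (intro \<beta>) auto
  moreover have "s ''e'' 0 = E"
    using s by (simp add: summed_def E_def)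
  ultimately have e: "bits (E + gain i k j) \<le> \<beta>" "s ''e'' 0 = E" .
  show "wp \<beta> (add_term m i) (\<lambda>s. summed i k (Suc j) s \<and> s ''j'' 0 = int j) s"
    using s e by (auto simp: add_term_def reads summed_def prepared_def step gain_def[of i k j]
        simp del: sum.lessThan_Suc)
qed

text \<open>The two loops are joined by \<open>built\<close> and \<open>summed\<close> at 0 and at
  \<open>n\<close>. After a miss the membership cells hold stale bits, harmlessly:
  \<open>''out''\<close> still has length 0, and the next check rewrites each bit before reading
  it.\<close>

lemma triple_check:
  assumes "i < m" "k < 2 ^ m"
  shows "triple n \<beta> (\<lambda>s. prepared s \<and> s ''out'' 0 = 0) (check m i k)
    (\<lambda>s. prepared s \<and> (if hit i k then s ''out'' 0 = int n + 1 \<and> s ''out'' 1 = int i \<and>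
       (\<forall>l<n. s ''out'' (2 + int l) = of_bool (l \<in> cand k)) else s ''out'' 0 = 0))"
    (is "triple n \<beta> ?P _ ?Q")
  unfolding check_def
proof (rule triple_Seq[OF _ triple_Seq[OF _ triple_Seq[OF _ triple_Seq]]])
  have "int k < 2 ^ m" using assms(2) by (metis of_nat_less_iff of_nat_numeral of_nat_power)
  then have "int k \<le> M" using M(3) by linarith
  then show "triple n \<beta> ?P (Seq (set_var ''k'' (N (int k))) (set_var ''w'' (N 0))) (built i k 0)"
    using M by (intro triple_loop_free)
      (auto simp: built_def prepared_def rank_def intro!: bits_M1)
  show "triple n \<beta> (built i k 0) (for_each (build m i)) (built i k n)"
    by (rule triple_for_each[OF triple_build[OF assms]]) (auto simp: built_def prepared_def)
  show "triple n \<beta> (built i k n)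
      (Seq (set_var ''r'' (Sub (bound_exp m i) (var ''w'')))
           (set_var ''e'' (Sub (N 0) (Mul (var ''w'') (var ''D''))))) (summed i k 0)"
  proof (rule triple_loop_free)
    fix s assume s: "built i k n s"
    then have "aval (bound_exp m i) s = d i"
      using inp_bound[OF assms(1)] inp_dim
      by (simp add: bound_exp_def dim_exp_def built_def prepared_def)
    moreover have "bits (res i k) \<le> \<beta>"
      using res_bound[OF assms(1), of k] by (intro bits_M[of _ 2]) auto
    moreover have "bits (- (weight i k * D)) \<le> \<beta>"
      using partial_excess[OF assms(1), of 0 k] by (intro \<beta>) auto
    ultimately show "wp \<beta> (Seq (set_var ''r'' (Sub (bound_exp m i) (var ''w'')))
        (set_var ''e'' (Sub (N 0) (Mul (var ''w'') (var ''D''))))) (summed i k 0) s"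
      using s by (simp add: built_def summed_def prepared_def weight_def[symmetric] res_def)
  qed
  show "triple n \<beta> (summed i k 0) (for_each (add_term m i)) (summed i k n)"
    by (rule triple_for_each[OF triple_add_term[OF assms(1)]]) (auto simp: summed_def prepared_def)
  show "triple n \<beta> (summed i k n)
      (Cond (Conj (Neg (Less (var ''r'') (N 0))) (Less (N 0) (var ''e'')))
        (Seq (Assign ''out'' (N 1) (N (int i))) (Assign ''out'' (N 0) (Add dim_exp (N 1))))
        SKIP) ?Q"
  proof (rule triple_loop_free)
    fix s assume s: "summed i k n s"
    have "bits (int i) \<le> \<beta>" "bits (int n + 1) \<le> \<beta>"
      using M assms(1) by (auto intro!: bits_M1)
    then show "wp \<beta> (Cond (Conj (Neg (Less (var ''r'') (N 0))) (Less (N 0) (var ''e'')))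
        (Seq (Assign ''out'' (N 1) (N (int i))) (Assign ''out'' (N 0) (Add dim_exp (N 1))))
        SKIP) ?Q s"
      using s inp_dim
      by (auto simp: summed_def prepared_def hit_def excess_def dim_exp_def not_less)
  qed
qed

text \<open>Writing an answer sets \<open>out 0\<close> to a positive value, which disables all later checks.\<close>

definition settled :: "(nat \<times> nat) set \<Rightarrow> state \<Rightarrow> bool" where
  "settled C s \<longleftrightarrow>
     (s ''out'' 0 = 0 \<and> (\<forall>(i, k)\<in>C. \<not> hit i k)) \<or>
     (\<exists>i k. i < m \<and> hit i k \<and> s ''out'' 0 = int n + 1 \<and> s ''out'' 1 = int i \<and>
       (\<forall>l<n. s ''out'' (2 + int l) = of_bool (l \<in> cand k)))"

text \<open>\<open>C\<close> collects the pairs handled so far. It is generalised so that the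
  induction can move the head of the list into it.\<close>

lemma triple_check_all:
  assumes "set xs \<subseteq> {..<m} \<times> {..<2 ^ m}"
  shows "triple n \<beta> (\<lambda>s. prepared s \<and> settled C s) (check_all m xs)
    (\<lambda>s. prepared s \<and> settled (C \<union> set xs) s)"
  using assms
proof (induction xs arbitrary: C)
  case Nil
  then show ?case by (auto intro: triple_loop_free)
next
  case (Cons x xs)
  obtain i k where x: "x = (i, k)" by fastforce
  with Cons.prems have ik: "i < m" "k < 2 ^ m" by auto
  have "triple n \<beta> (\<lambda>s. prepared s \<and> settled C s)
      (Cond (Less (var ''out'') (N 1)) (check m i k) SKIP)
      (\<lambda>s. prepared s \<and> settled (insert x C) s)"
  proof (rule triple_Cond)
    \<comment> \<open>That the earlier pairs are misses does not depend on the state, so it is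
      carried through \<open>triple_check\<close> unchanged.\<close>
    have "triple n \<beta> (\<lambda>s. (prepared s \<and> s ''out'' 0 = 0) \<and> (\<forall>(i, k)\<in>C. \<not> hit i k)) (check m i k)
      (\<lambda>s. (prepared s \<and> (if hit i k then s ''out'' 0 = int n + 1 \<and> s ''out'' 1 = int i \<and>
        (\<forall>l<n. s ''out'' (2 + int l) = of_bool (l \<in> cand k)) else s ''out'' 0 = 0))
        \<and> (\<forall>(i, k)\<in>C. \<not> hit i k))"
      using triple_check[OF ik] unfolding triple_def by blast
    then show "triple n \<beta> (\<lambda>s. (prepared s \<and> settled C s) \<and> bval (Less (var ''out'') (N 1)) s)
        (check m i k) (\<lambda>s. prepared s \<and> settled (insert x C) s)"
    proof (rule triple_conseq)
      fix s assume *: "(prepared s \<and> (if hit i k then s ''out'' 0 = int n + 1 \<and> s ''out'' 1 = int i \<and>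
        (\<forall>l<n. s ''out'' (2 + int l) = of_bool (l \<in> cand k)) else s ''out'' 0 = 0))
        \<and> (\<forall>(i, k)\<in>C. \<not> hit i k)"
      show "prepared s \<and> settled (insert x C) s"
      proof (cases "hit i k")
        case True
        with * ik show ?thesis
          unfolding settled_def by (intro conjI disjI2 exI[of _ i] exI[of _ k]) simp_all
      next
        case False
        with * show ?thesis by (simp add: settled_def x)
      qed
    \<comment> \<open>The guard forces \<open>s ''out'' 0 < 1\<close>, which excludes the disjunct
      with value \<open>int n + 1\<close>.\<close>
    qed (auto simp: settled_def)
    show "triple n \<beta> (\<lambda>s. (prepared s \<and> settled C s) \<and> \<not> bval (Less (var ''out'') (N 1)) s)
        SKIP (\<lambda>s. prepared s \<and> settled (insert x C) s)"
    proof (rule triple_loop_free)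
      fix s assume "(prepared s \<and> settled C s) \<and> \<not> bval (Less (var ''out'') (N 1)) s"
      moreover from this have "settled (insert x C) s"
        unfolding settled_def by (elim conjE disjE) (simp, blast)
      ultimately show "wp \<beta> SKIP (\<lambda>s. prepared s \<and> settled (insert x C) s) s" by simp
    qed
  qed
  moreover have "triple n \<beta> (\<lambda>s. prepared s \<and> settled (insert x C) s) (check_all m xs)
      (\<lambda>s. prepared s \<and> settled (C \<union> set (x # xs)) s)"
    using Cons.IH[of "insert x C"] Cons.prems by simp
  ultimately show ?case unfolding x check_all.simps by (rule triple_Seq)
qed

lemma triple_separate:
  "triple n \<beta> (\<lambda>s. s ''in'' = inp \<and> s ''out'' 0 = 0) (separate m)
    (settled ({..<m} \<times> {..<2 ^ m}))"
  unfolding separate_def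
proof (rule triple_Seq[OF triple_init])
  have "triple n \<beta> (\<lambda>s. prepared s \<and> settled {} s)
      (check_all m (List.product [0..<m] [0..<2 ^ m]))
      (\<lambda>s. prepared s \<and> settled ({} \<union> set (List.product [0..<m] [0..<2 ^ m])) s)"
    by (rule triple_check_all) auto
  then show "triple n \<beta> (\<lambda>s. prepared s \<and> s ''out'' 0 = 0)
      (check_all m (List.product [0..<m] [0..<2 ^ m])) (settled ({..<m} \<times> {..<2 ^ m}))"
    by (rule triple_conseq) (auto simp: settled_def atLeast0LessThan)
qed

end


section \<open>Violated weight inequalities at extreme points\<close>

text \<open>Gaussian elimination by induction on the number of equations. If the last equation
  vanishes on \<open>F\<close>, it is dropped. Otherwise a pivot \<open>k\<close> is eliminated from
  the others, which gives \<open>g\<close>, and the value \<open>c\<close> at \<open>k\<close> is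
  chosen to satisfy the last equation.\<close>

lemma nontrivial_kernel:
  fixes f :: "nat \<Rightarrow> 'a \<Rightarrow> 'b :: field"
  assumes "finite F" "m < card F"
  shows "\<exists>y. (\<exists>j\<in>F. y j \<noteq> 0) \<and> (\<forall>i<m. (\<Sum>j\<in>F. f i j * y j) = 0)"
  using assms
proof (induction m arbitrary: f F)
  case 0
  then obtain j where "j \<in> F" by fastforce
  then show ?case by (intro exI[of _ "\<lambda>_. 1"]) auto
next
  case (Suc m)
  show ?case
  proof (cases "\<forall>j\<in>F. f m j = 0")
    case True
    obtain y where y: "\<exists>j\<in>F. y j \<noteq> 0" "\<And>i. i < m \<Longrightarrow> (\<Sum>j\<in>F. f i j * y j) = 0"
      using Suc.IH[of F f] Suc.prems by (meson Suc_lessD)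
    have "(\<Sum>j\<in>F. f i j * y j) = 0" if "i < Suc m" for i
    proof (cases "i = m")
      case True
      then show ?thesis using \<open>\<forall>j\<in>F. f m j = 0\<close> by simp
    qed (use that y(2) in simp)
    then show ?thesis using y(1) by blast
  next
    case False
    then obtain k where k: "k \<in> F" "f m k \<noteq> 0" by blast
    define g where "g i j = f i j - f i k * f m j / f m k" for i j
    have "m < card (F - {k})" using Suc.prems k by simp
    then obtain y where y: "\<exists>j\<in>F - {k}. y j \<noteq> 0"
        "\<And>i. i < m \<Longrightarrow> (\<Sum>j\<in>F - {k}. g i j * y j) = 0"
      using Suc.IH[of "F - {k}" g] Suc.prems by blast
    define c where "c = - (\<Sum>j\<in>F - {k}. f m j * y j) / f m k"
    let ?y = "y(k := c)"
    have split: "(\<Sum>j\<in>F. f i j * ?y j) = f i k * c + (\<Sum>j\<in>F - {k}. f i j * y j)" for i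
      using k Suc.prems by (simp add: sum.remove[of F k])
    have "(\<Sum>j\<in>F. f i j * ?y j) = 0" if "i < Suc m" for i
    proof (cases "i = m")
      case True
      then show ?thesis unfolding split unfolding c_def using k by simp
    next
      case False
      have "(\<Sum>j\<in>F - {k}. g i j * y j) =
          (\<Sum>j\<in>F - {k}. f i j * y j) - (\<Sum>j\<in>F - {k}. f i k / f m k * (f m j * y j))"
        by (simp add: g_def sum_subtractf[symmetric] algebra_simps)
      also have "\<dots> = (\<Sum>j\<in>F - {k}. f i j * y j) + f i k * c"
        by (simp add: c_def sum_distrib_left[symmetric] sum_divide_distrib[symmetric])
      finally show ?thesis unfolding split using y(2)[of i] False that by (simp add: add.commute)
    qed
    moreover have "\<exists>j\<in>F. ?y j \<noteq> 0" using y(1) by (auto intro: bexI[rotated])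
    ultimately show ?thesis by blast
  qed
qed

lemma extreme_point_card_fractional:
  assumes A: "A \<in> carrier_mat m n"
    and ext: "extreme_point x (lp_polytope A d)"
  shows "card {j. j < n \<and> 0 < x $ j \<and> x $ j < 1} \<le> m"
proof (rule ccontr)
  let ?F = "{j. j < n \<and> 0 < x $ j \<and> x $ j < 1}"
  assume "\<not> card ?F \<le> m"
  then obtain y where y: "\<exists>j\<in>?F. y j \<noteq> 0"
      "\<And>i. i < m \<Longrightarrow> (\<Sum>j\<in>?F. real (A $$ (i, j)) * y j) = 0"
    using nontrivial_kernel[of ?F m "\<lambda>i j. real (A $$ (i, j))"] by auto
  have x: "x \<in> lp_polytope A d" "dim_vec x = n"
    using ext A by (auto simp: extreme_point_def lp_polytope_def)
  have xn: "x \<in> carrier_vec n" using x(2) by (rule carrier_vecI)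
  define w where "w = vec n (\<lambda>j. if j \<in> ?F then y j else 0)"
  have w: "w \<in> carrier_vec n" by (simp add: w_def)
  have Aw: "row (map_mat real A) i \<bullet> w = 0" if "i < m" for i
  proof -
    have "row (map_mat real A) i \<bullet> w =
        (\<Sum>j\<in>{0..<n}. if j \<in> ?F then real (A $$ (i, j)) * y j else 0)"
      unfolding scalar_prod_def using A that by (intro sum.cong) (auto simp: w_def)
    also have "\<dots> = (\<Sum>j\<in>?F. real (A $$ (i, j)) * y j)"
      by (rule sum.mono_neutral_cong_right) auto
    finally show ?thesis using y(2)[OF that] by simp
  qed
  \<comment> \<open>Each quotient keeps \<open>e * |y j|\<close> below the distance of
    \<open>x $ j\<close> to 0 and to 1; the summand 1 makes the denominator positive.\<close>
  define e where "e = Min (insert 1 ((\<lambda>j. min (x $ j) (1 - x $ j) / (1 + \<bar>y j\<bar>)) ` ?F))"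
  have e: "e > 0" unfolding e_def by (subst Min_gr_iff) auto
  have e_le: "e * \<bar>y j\<bar> \<le> min (x $ j) (1 - x $ j)" if "j \<in> ?F" for j
  proof -
    have "e \<le> min (x $ j) (1 - x $ j) / (1 + \<bar>y j\<bar>)"
      unfolding e_def using that by (intro Min_le) auto
    then have "e * (1 + \<bar>y j\<bar>) \<le> min (x $ j) (1 - x $ j)"
      by (subst (asm) pos_le_divide_eq) auto
    then show ?thesis using e by (simp add: algebra_simps)
  qed
  \<comment> \<open>Rows keep their values since \<open>w\<close> lies in the kernel, and
    \<open>w\<close> vanishes off the fractional positions, so only the bounds at those positions
    depend on \<open>e\<close>.\<close>
  have mem: "x + t \<cdot>\<^sub>v w \<in> lp_polytope A d" if "\<bar>t\<bar> \<le> e" for t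
  proof -
    have "map_mat real A *\<^sub>v (x + t \<cdot>\<^sub>v w) = map_mat real A *\<^sub>v x"
    proof (rule eq_vecI)
      fix i assume "i < dim_vec (map_mat real A *\<^sub>v x)"
      then have i: "i < m" using A by simp
      have r: "row (map_mat real A) i \<in> carrier_vec n"
        using A by (intro carrier_vecI) simp
      have "row (map_mat real A) i \<bullet> (x + t \<cdot>\<^sub>v w) =
          row (map_mat real A) i \<bullet> x + t * (row (map_mat real A) i \<bullet> w)"
        using scalar_prod_add_distrib[OF r xn smult_carrier_vec[THEN iffD2, OF w]]
          scalar_prod_smult_distrib[OF r w] by simp
      then show "(map_mat real A *\<^sub>v (x + t \<cdot>\<^sub>v w)) $ i = (map_mat real A *\<^sub>v x) $ i"
        using i A Aw by simp
    qed simp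
    moreover have "0 \<le> (x + t \<cdot>\<^sub>v w) $ j \<and> (x + t \<cdot>\<^sub>v w) $ j \<le> 1" if j: "j < n" for j
    proof (cases "j \<in> ?F")
      case True
      have "\<bar>t * y j\<bar> \<le> e * \<bar>y j\<bar>"
        unfolding abs_mult using \<open>\<bar>t\<bar> \<le> e\<close> by (intro mult_right_mono) auto
      with e_le[OF True] have "\<bar>t * y j\<bar> \<le> x $ j" "\<bar>t * y j\<bar> \<le> 1 - x $ j" by auto
      then show ?thesis using True j w x(2) by (simp add: w_def abs_le_iff)
    next
      case False
      then have "(x + t \<cdot>\<^sub>v w) $ j = x $ j" using j w by (simp add: w_def del: mem_Collect_eq)
      then show ?thesis using x A j by (simp add: lp_polytope_def)
    qed
    moreover have "x + t \<cdot>\<^sub>v w \<in> carrier_vec n"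
      using xn w by (intro add_carrier_vec) auto
    moreover have "map_mat real A *\<^sub>v x \<le> map_vec real d" "dim_col A = n"
      using x A by (auto simp: lp_polytope_def)
    ultimately show ?thesis
      unfolding lp_polytope_def by (simp only: mem_Collect_eq) blast
  qed
  have entry: "(x + t \<cdot>\<^sub>v w) $ j = x $ j + t * w $ j" if "j < n" for t j
    using that w by simp
  obtain j where j: "j < n" "w $ j \<noteq> 0" using y(1) by (auto simp: w_def)
  have "(x + (- e) \<cdot>\<^sub>v w) $ j \<noteq> (x + e \<cdot>\<^sub>v w) $ j"
    unfolding entry[OF j(1)] using j(2) e by simp
  then have 1: "x + (- e) \<cdot>\<^sub>v w \<noteq> x + e \<cdot>\<^sub>v w" by metis
  \<comment> \<open>\<open>x\<close> is the midpoint of the segment, that is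
    \<open>u = 1 / 2\<close> in \<open>extreme_point\<close>.\<close>
  have 2: "x = (1 - 1 / 2) \<cdot>\<^sub>v (x + (- e) \<cdot>\<^sub>v w) + (1 / 2) \<cdot>\<^sub>v (x + e \<cdot>\<^sub>v w)"
  proof (rule eq_vecI)
    fix j assume "j < dim_vec ((1 - 1 / 2) \<cdot>\<^sub>v (x + (- e) \<cdot>\<^sub>v w) + (1 / 2) \<cdot>\<^sub>v (x + e \<cdot>\<^sub>v w))"
    then have j: "j < n" "j < dim_vec w" using w by simp_all
    show "x $ j = ((1 - 1 / 2) \<cdot>\<^sub>v (x + (- e) \<cdot>\<^sub>v w) + (1 / 2) \<cdot>\<^sub>v (x + e \<cdot>\<^sub>v w)) $ j"
      using j by (simp add: entry field_simps)
  qed (use w x(2) in simp)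
  have 3: "x + (- e) \<cdot>\<^sub>v w \<in> lp_polytope A d" "x + e \<cdot>\<^sub>v w \<in> lp_polytope A d"
    using e by (simp_all only: mem abs_minus_cancel abs_of_pos order_refl)
  have "\<not> (y \<noteq> z \<and> 0 < u \<and> u < 1 \<and> x = (1 - u) \<cdot>\<^sub>v y + u \<cdot>\<^sub>v z)"
    if "y \<in> lp_polytope A d" "z \<in> lp_polytope A d" for y z and u :: real
    using ext that unfolding extreme_point_def by blast
  from this[OF 3, of "1 / 2"] 1 2 show False by simp
qed

section \<open>Changing the pack of a violated inequality in a single row\<close>

context
  fixes I :: "nat set" and a x :: "nat \<Rightarrow> real" and b :: real
  assumes I: "finite I"
    and a: "\<And>j. j \<in> I \<Longrightarrow> 0 \<le> a j"
    and x: "\<And>j. j \<in> I \<Longrightarrow> 0 \<le> x j"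
    and feasible: "(\<Sum>j\<in>I. a j * x j) \<le> b"
begin

abbreviation (input) residual :: "nat set \<Rightarrow> real" where
  "residual P \<equiv> b - (\<Sum>j\<in>P. a j)"

abbreviation (input) violated :: "nat set \<Rightarrow> bool" where
  "violated P \<equiv> \<not> (\<Sum>j\<in>P. a j * x j) + (\<Sum>j\<in>I - P. max (a j - residual P) 0 * x j) \<le> (\<Sum>j\<in>P. a j)"

text \<open>Splitting \<open>a j\<close> into \<open>max (a j - r) 0 + min (a j) r\<close>, with
  \<open>r\<close> the residual, gives coefficients that are monotone in \<open>r\<close>. The
  right-hand side is \<open>r\<close> minus the slack of the row at \<open>x\<close>.\<close>

lemma violated_iff:
  assumes "P \<subseteq> I"
  shows "violated P \<longleftrightarrow>
    (\<Sum>j\<in>I - P. min (a j) (residual P) * x j) < residual P - (b - (\<Sum>j\<in>I. a j * x j))"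
proof -
  have "(\<Sum>j\<in>I. a j * x j) = (\<Sum>j\<in>P. a j * x j) + (\<Sum>j\<in>I - P. a j * x j)"
    using I assms by (simp add: sum.subset_diff)
  moreover have "(\<Sum>j\<in>I - P. a j * x j) = (\<Sum>j\<in>I - P. max (a j - residual P) 0 * x j) +
      (\<Sum>j\<in>I - P. min (a j) (residual P) * x j)"
    unfolding sum.distrib[symmetric]
    by (intro sum.cong) (auto simp: max_def min_def algebra_simps)
  ultimately show ?thesis by linarith
qed

text \<open>With \<open>e\<close> the weight of \<open>Z\<close>, the right-hand side of
  \<open>violated_iff\<close> grows by \<open>e\<close>. On the left only terms with
  \<open>a j > r\<close> can grow, each by at most \<open>e * x j\<close>, and violation forces
  these \<open>x j\<close> to sum to less than 1.\<close>

lemma violated_remove_zeros: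
  assumes P: "P \<subseteq> I" "0 \<le> residual P" "violated P" and Z: "Z \<subseteq> P" "\<And>j. j \<in> Z \<Longrightarrow> x j = 0"
  shows "0 \<le> residual (P - Z) \<and> violated (P - Z)"
proof -
  define r where "r = residual P"
  define e where "e = (\<Sum>j\<in>Z. a j)"
  have fin: "finite P" "finite Z" using I P Z by (auto intro: finite_subset)
  have e: "e \<ge> 0" unfolding e_def using a Z P by (intro sum_nonneg) auto
  have r': "residual (P - Z) = r + e"
    using fin Z by (simp add: r_def e_def sum_diff)
  have v: "(\<Sum>j\<in>I - P. min (a j) r * x j) < r - (b - (\<Sum>j\<in>I. a j * x j))"
    using P violated_iff r_def by simp
  define G where "G = {j \<in> I - P. r < a j}"
  have nn: "0 \<le> min (a j) r * x j" if "j \<in> I" for j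
    using that a x P by (simp add: r_def)
  have "(\<Sum>j\<in>G. min (a j) r * x j) \<le> (\<Sum>j\<in>I - P. min (a j) r * x j)"
    unfolding G_def using I nn by (intro sum_mono2) auto
  moreover have "(\<Sum>j\<in>G. min (a j) r * x j) = r * (\<Sum>j\<in>G. x j)"
    unfolding sum_distrib_left by (intro sum.cong) (auto simp: G_def)
  \<comment> \<open>The terms in \<open>G\<close> alone contribute \<open>r\<close> times their sum
    of \<open>x j\<close>, while the whole sum is below \<open>r\<close> because the slack of the
    row is nonnegative.\<close>
  ultimately have "r * (\<Sum>j\<in>G. x j) < r * 1"
    using v feasible by simp
  then have G: "(\<Sum>j\<in>G. x j) < 1"
    using P(2) mult_left_mono[of 1 "\<Sum>j\<in>G. x j" r] by (fastforce simp: r_def)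
  have "(\<Sum>j\<in>I - (P - Z). min (a j) (r + e) * x j) = (\<Sum>j\<in>I - P. min (a j) (r + e) * x j)"
    using I P Z by (intro sum.mono_neutral_right) auto
  also have "\<dots> \<le> (\<Sum>j\<in>I - P. min (a j) r * x j + (if j \<in> G then e * x j else 0))"
  proof (rule sum_mono)
    fix j assume j: "j \<in> I - P"
    have "min (a j) (r + e) \<le> min (a j) r + (if j \<in> G then e else 0)"
      using j e by (auto simp: G_def min_def)
    from mult_right_mono[OF this x] j
    show "min (a j) (r + e) * x j \<le> min (a j) r * x j + (if j \<in> G then e * x j else 0)"
      by (auto simp: distrib_right split: if_splits)
  qed
  also have "\<dots> = (\<Sum>j\<in>I - P. min (a j) r * x j) + e * (\<Sum>j\<in>G. x j)"
  proof -
    have "(\<Sum>j\<in>I - P. if j \<in> G then e * x j else 0) = (\<Sum>j\<in>G. e * x j)"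
      using I by (intro sum.mono_neutral_cong_right) (auto simp: G_def)
    then show ?thesis by (simp add: sum.distrib sum_distrib_left)
  qed
  also have "e * (\<Sum>j\<in>G. x j) \<le> e * 1" using G e by (intro mult_left_mono) auto
  finally have "violated (P - Z)"
    using v unfolding violated_iff[OF subset_trans[OF Diff_subset P(1)]] unfolding r' by linarith
  moreover have "0 \<le> residual (P - Z)" unfolding r' using P(2) e by (simp add: r_def)
  ultimately show ?thesis by blast
qed

text \<open>An element of \<open>U\<close> with \<open>a j \<ge> r\<close> would contribute
  \<open>r\<close> on its own and prevent violation. So \<open>U\<close> contributes exactly its
  weight to the left side; moving it into the pack removes this weight from both sides, and the
  remaining minima can only shrink.\<close>

lemma violated_add_ones:
  assumes P: "P \<subseteq> I" "0 \<le> residual P" "violated P" and U: "U \<subseteq> I - P" "\<And>j. j \<in> U \<Longrightarrow> x j = 1"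
  shows "0 \<le> residual (P \<union> U) \<and> violated (P \<union> U)"
proof -
  define r where "r = residual P"
  have fin: "finite P" "finite U" using I P U by (auto intro: finite_subset)
  have r': "residual (P \<union> U) = r - (\<Sum>j\<in>U. a j)"
    using fin U by (subst sum.union_disjoint) (auto simp: r_def)
  have v: "(\<Sum>j\<in>I - P. min (a j) r * x j) < r - (b - (\<Sum>j\<in>I. a j * x j))"
    using P violated_iff r_def by simp
  have nn: "0 \<le> min (a j) r * x j" if "j \<in> I" for j
    using that a x P by (simp add: r_def)
  have less: "a j < r" if "j \<in> U" for j
  proof (rule ccontr)
    assume "\<not> a j < r"
    then have "r = min (a j) r * x j" using U that by simp
    also have "\<dots> \<le> (\<Sum>j\<in>I - P. min (a j) r * x j)"
      using that U I nn by (intro member_le_sum) auto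
    finally show False using v feasible by simp
  qed
  have "(\<Sum>j\<in>I - (P \<union> U). min (a j) (r - (\<Sum>j\<in>U. a j)) * x j) \<le>
      (\<Sum>j\<in>I - (P \<union> U). min (a j) r * x j)"
  proof (intro sum_mono mult_right_mono)
    have "0 \<le> (\<Sum>j\<in>U. a j)" using U a by (intro sum_nonneg) auto
    then show "min (a j) (r - (\<Sum>j\<in>U. a j)) \<le> min (a j) r" for j by auto
  qed (use x in auto)
  moreover have "(\<Sum>j\<in>I - P. min (a j) r * x j) =
      (\<Sum>j\<in>I - (P \<union> U). min (a j) r * x j) + (\<Sum>j\<in>U. min (a j) r * x j)"
    using sum.subset_diff[of U "I - P" "\<lambda>j. min (a j) r * x j"] U I
    by (simp add: Diff_Diff_Int set_diff_eq conj_ac Un_def)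
  moreover have "(\<Sum>j\<in>U. min (a j) r * x j) = (\<Sum>j\<in>U. a j)"
    using less U by (intro sum.cong) (auto simp: min_def less_imp_le)
  \<comment> \<open>This makes the weight of \<open>U\<close> at most the whole sum, hence less than
    \<open>r\<close>, so the enlarged set is still a pack.\<close>
  moreover have "0 \<le> (\<Sum>j\<in>I - (P \<union> U). min (a j) r * x j)"
    using nn by (intro sum_nonneg) auto
  moreover have "P \<union> U \<subseteq> I" using P U by blast
  ultimately show ?thesis
    using v feasible unfolding violated_iff[OF \<open>P \<union> U \<subseteq> I\<close>] unfolding r'
    by (intro conjI) linarith+
qed

end

text \<open>The mask is built from the low bits up. The bound on \<open>k\<close> makes the next bit
  0 by default, and it is set by adding a power of two if \<open>n\<close> is a marked element of
  \<open>S\<close>.\<close>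

lemma mask_exists:
  "\<exists>k :: nat. k < 2 ^ card {l. l < n \<and> F l} \<and> (\<forall>j<n. F j \<longrightarrow>
     odd (k div 2 ^ card {l. l < j \<and> F l}) = (j \<in> S))" for n :: nat
proof (induction n)
  case 0
  show ?case by (intro exI[of _ 0]) simp
next
  case (Suc n)
  let ?c = "\<lambda>j. card {l. l < j \<and> F l}"
  obtain k :: nat where k: "k < 2 ^ ?c n" "\<And>j. j < n \<Longrightarrow> F j \<Longrightarrow> odd (k div 2 ^ ?c j) = (j \<in> S)"
    using Suc.IH by blast
  have c: "?c (Suc n) = ?c n + of_bool (F n)"
  proof -
    have "{l. l < Suc n \<and> F l} = (if F n then insert n else id) {l. l < n \<and> F l}"
      by (auto simp: less_Suc_eq)
    then show ?thesis by simp
  qed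
  show ?case
  proof (cases "F n \<and> n \<in> S")
    case False
    have "k < 2 ^ ?c (Suc n)"
      using k(1) unfolding c by (auto intro: less_le_trans)
    moreover have "odd (k div 2 ^ ?c j) = (j \<in> S)" if "j < Suc n" "F j" for j
      using that k False by (cases "j = n") auto
    ultimately show ?thesis by blast
  next
    case True
    let ?k = "k + 2 ^ ?c n"
    have "?k < 2 ^ ?c (Suc n)" using k(1) True unfolding c by simp
    moreover have "odd (?k div 2 ^ ?c j) = (j \<in> S)" if "j < Suc n" "F j" for j
    proof (cases "j = n")
      case True
      then show ?thesis using \<open>F n \<and> n \<in> S\<close> k(1) by simp
    next
      case False
      with that have j: "j < n" by simp
      have "?c j < ?c n"
        using j that(2) by (intro psubset_card_mono) auto
      then obtain e where e: "?c n = ?c j + Suc e"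
        using less_iff_Suc_add by (metis add_Suc_right)
      \<comment> \<open>The new top bit contributes an even number here, so the lower bits keep
        their parity tests.\<close>
      have "?k div 2 ^ ?c j = k div 2 ^ ?c j + 2 ^ Suc e"
        unfolding e power_add by (simp add: mult.commute)
      then show ?thesis using k(2)[OF j that(2)] by simp
    qed
    ultimately show ?thesis by blast
  qed
qed

section \<open>From masks to violated inequalities and back\<close>

lemma (in wi_data) weight_eq: "weight i k = (\<Sum>l\<in>cand k. a i l)"
  unfolding weight_def
  by (rule sum.mono_neutral_cong_right) (auto simp: cand_def)

text \<open>Each denominator divides \<open>D\<close>, so the integer division in \<open>X\<close>
  is exact.\<close>

lemma (in wi_data) X_eq:
  assumes "j < n"
  shows "real_of_int (X j) = real_of_int D * (real_of_int (p j) / real_of_int (q j))"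
proof -
  have "q j dvd D" unfolding D_def using assms by (intro dvd_prodI) auto
  then show ?thesis by (auto simp: X_def real_of_int_div)
qed

text \<open>By \<open>X_eq\<close>, \<open>excess i k\<close> is \<open>D\<close> times the left
  side minus the right side of the weight inequality, and \<open>D\<close> is positive.\<close>

lemma (in wi_data) hit_iff:
  fixes k :: nat
  assumes i: "i < m"
  defines "P \<equiv> cand k"
  defines "x \<equiv> \<lambda>j. real_of_int (p j) / real_of_int (q j)"
  shows "hit i k \<longleftrightarrow> (\<Sum>j\<in>P. real_of_int (a i j)) \<le> real_of_int (d i) \<and>
    \<not> (\<Sum>j\<in>P. real_of_int (a i j) * x j) +
      (\<Sum>j\<in>{..<n} - P. max (real_of_int (a i j) -
         (real_of_int (d i) - (\<Sum>j\<in>P. real_of_int (a i j)))) 0 * x j)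
      \<le> (\<Sum>j\<in>P. real_of_int (a i j))"
proof -
  have P: "P \<subseteq> {..<n}" by (auto simp: P_def cand_def)
  have w: "real_of_int (weight i k) = (\<Sum>j\<in>P. real_of_int (a i j))"
    by (simp add: weight_eq P_def)
  have r: "real_of_int (res i k) = real_of_int (d i) - (\<Sum>j\<in>P. real_of_int (a i j))"
    by (simp add: res_def w)
  have g1: "real_of_int (gain i k j) = D * (a i j * x j)" if "j \<in> P" for j
    using that P X_eq[of j] by (auto simp: gain_def P_def x_def)
  have g2: "real_of_int (gain i k j) = D * (max (a i j - res i k) 0 * x j)" if "j \<in> {..<n} - P" for j
    using that X_eq[of j] by (auto simp: gain_def P_def x_def max_def)
  have "real_of_int (\<Sum>j<n. gain i k j) =
      (\<Sum>j\<in>{..<n} - P. real_of_int (gain i k j)) + (\<Sum>j\<in>P. real_of_int (gain i k j))"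
    using P by (simp add: sum.subset_diff)
  also have "\<dots> = D * ((\<Sum>j\<in>{..<n} - P. max (a i j - res i k) 0 * x j) + (\<Sum>j\<in>P. a i j * x j))"
    by (simp add: g1 g2 sum_distrib_left distrib_left)
  finally have "real_of_int (excess i k) = D * ((\<Sum>j\<in>P. a i j * x j) +
      (\<Sum>j\<in>{..<n} - P. max (a i j - res i k) 0 * x j) - (\<Sum>j\<in>P. real_of_int (a i j)))"
    by (simp add: excess_def w algebra_simps)
  then have "0 < excess i k \<longleftrightarrow> 0 < real_of_int D * ((\<Sum>j\<in>P. a i j * x j) +
      (\<Sum>j\<in>{..<n} - P. max (a i j - res i k) 0 * x j) - (\<Sum>j\<in>P. real_of_int (a i j)))"
    by (metis of_int_0_less_iff)
  also have "\<dots> \<longleftrightarrow> \<not> (\<Sum>j\<in>P. a i j * x j) +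
      (\<Sum>j\<in>{..<n} - P. max (a i j - res i k) 0 * x j) \<le> (\<Sum>j\<in>P. real_of_int (a i j))"
    using D_pos by (simp add: zero_less_mult_iff not_le)
  finally have e: "0 < excess i k \<longleftrightarrow> \<dots>" .
  have "0 \<le> res i k \<longleftrightarrow> (\<Sum>j\<in>P. real_of_int (a i j)) \<le> real_of_int (d i)"
    using r by linarith
  then show ?thesis
    unfolding hit_def e by (simp add: r of_int_max)
qed

text \<open>Removing the zeros \<open>Z\<close> and then adding the ones \<open>U\<close> normalises
  the pack. It is then determined by its fractional members, which a mask below \<open>2 ^ m\<close>
  can select as there are at most \<open>m\<close> of them.\<close>

lemma (in wi_data) hit_exists:
  fixes i :: nat
  defines "x \<equiv> \<lambda>j. real_of_int (p j) / real_of_int (q j)"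
  defines "b \<equiv> real_of_int (d i)"
  assumes i: "i < m" and P: "P \<subseteq> {..<n}" "(\<Sum>j\<in>P. real_of_int (a i j)) \<le> b"
    and viol: "\<not> (\<Sum>j\<in>P. real_of_int (a i j) * x j) +
      (\<Sum>j\<in>{..<n} - P. max (real_of_int (a i j) - (b - (\<Sum>j\<in>P. real_of_int (a i j)))) 0 * x j)
      \<le> (\<Sum>j\<in>P. real_of_int (a i j))"
    and feasible: "(\<Sum>j<n. real_of_int (a i j) * x j) \<le> b"
    and few: "card {j. j < n \<and> frac j} \<le> m"
  shows "\<exists>k < 2 ^ m. hit i k"
proof -
  let ?a = "\<lambda>j. real_of_int (a i j)"
  have a: "0 \<le> ?a j" if "j \<in> {..<n}" for j
    using coeff(1)[OF i] that by simp
  have x: "0 \<le> x j" "x j \<le> 1" if "j \<in> {..<n}" for j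
    using quotient[of j] that by (auto simp: x_def)
  define Z where "Z = {j \<in> P. p j = 0}"
  define U where "U = {j \<in> {..<n} - P. p j = q j}"
  let ?P = "(P - Z) \<union> U"
  have "0 \<le> b - (\<Sum>j\<in>P - Z. ?a j) \<and> \<not> (\<Sum>j\<in>P - Z. ?a j * x j) +
      (\<Sum>j\<in>{..<n} - (P - Z). max (?a j - (b - (\<Sum>j\<in>P - Z. ?a j))) 0 * x j) \<le> (\<Sum>j\<in>P - Z. ?a j)"
    using P viol by (intro violated_remove_zeros a x feasible) (auto simp: Z_def x_def)
  moreover have "U \<subseteq> {..<n} - (P - Z)" by (auto simp: U_def)
  moreover have "x j = 1" if "j \<in> U" for j
    using that quotient(3)[of j] by (auto simp: U_def x_def)
  ultimately have v: "0 \<le> b - (\<Sum>j\<in>?P. ?a j) \<and> \<not> (\<Sum>j\<in>?P. ?a j * x j) +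
      (\<Sum>j\<in>{..<n} - ?P. max (?a j - (b - (\<Sum>j\<in>?P. ?a j))) 0 * x j) \<le> (\<Sum>j\<in>?P. ?a j)"
    using P(1) by (intro violated_add_ones a x feasible) auto
  obtain k :: nat where k: "k < 2 ^ card {l. l < n \<and> frac l}"
      "\<And>j. j < n \<Longrightarrow> frac j \<Longrightarrow> odd (k div 2 ^ rank j) = (j \<in> ?P)"
    using mask_exists[of n frac ?P] unfolding rank_def by blast
  have "j \<in> cand k \<longleftrightarrow> j \<in> ?P" for j
  proof (cases "j < n")
    case True
    then consider "frac j" | "p j = 0" "\<not> frac j" "p j \<noteq> q j" | "p j = q j" "\<not> frac j" "p j \<noteq> 0"
      using quotient[of j] by (force simp: frac_def)
    then show ?thesis
    proof cases
      case 1
      then show ?thesis using True k(2)[OF True 1] by (auto simp: cand_def frac_def)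
    next
      case 2
      then show ?thesis by (simp add: cand_def Z_def U_def)
    next
      case 3
      then show ?thesis using True by (simp add: cand_def Z_def U_def)
    qed
  next
    case False
    then show ?thesis using P(1) by (auto simp: cand_def U_def)
  qed
  then have "cand k = ?P" by blast
  then have "hit i k"
    using v hit_iff[OF i, of k] by (simp add: x_def b_def)
  moreover have "k < 2 ^ m"
    using k(1) few by (meson less_le_trans one_le_numeral power_increasing)
  ultimately show ?thesis by blast
qed

section \<open>Encoded instances\<close>

lemma nth_concat_uniform:
  assumes "\<And>i. i < k \<Longrightarrow> length (f i) = l" "i < k" "j < l"
  shows "concat (map f [0..<k]) ! (i * l + j) = f i ! j"
  using assms
proof (induction k)
  case (Suc k)
  have len: "length (concat (map f [0..<k])) = k * l"
  proof -
    have "length (concat (map f [0..<k'])) = k' * l" if "k' \<le> k" for k'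
      using that by (induction k') (auto simp: Suc.prems(1))
    then show ?thesis by simp
  qed
  show ?case
  proof (cases "i = k")
    case True
    then show ?thesis using len by (simp add: nth_append)
  next
    case False
    then have "i < k" using Suc.prems by simp
    then have "i * l + j < k * l"
      using Suc.prems(3) mult_le_mono1[of "Suc i" k l] by simp
    then show ?thesis using len Suc.IH Suc.prems \<open>i < k\<close> by (simp add: nth_append)
  qed
qed simp

lemma list_bits_append: "list_bits (v @ w) = list_bits v + list_bits w"
  by (simp add: list_bits_def)

lemma length_le_list_bits: "length w \<le> list_bits w"
proof (induction w)
  case (Cons z w)
  then show ?case using bits_ge_1[of z] by (simp add: list_bits_def)
qed simp

lemma bits_le_list_bits: "z \<in> set w \<Longrightarrow> bits z \<le> list_bits w"
  unfolding list_bits_def by (intro member_le_sum_list) auto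

lemma list_bits_le: "(\<And>z. z \<in> set w \<Longrightarrow> bits z \<le> b) \<Longrightarrow> list_bits w \<le> length w * b"
  by (induction w) (auto simp: list_bits_def intro: add_mono)

lemma abs_le_power_bits: "\<bar>z\<bar> \<le> 2 ^ bits z"
proof -
  have "(2 :: int) ^ (bits z - 1) \<le> 2 ^ bits z" by (intro power_increasing) auto
  then show ?thesis using abs_less_bits[of z] by linarith
qed

text \<open>Natural coefficients are nonnegative. This replaces the iteration count by the input
  length.\<close>

lemma poly_mono_nat: "x \<le> y \<Longrightarrow> poly p x \<le> poly p y" for p :: "nat poly"
  by (induction p) (auto intro: add_mono mult_mono)

lemma bits_input_state: "bits (input_state w v i) \<le> Suc (Suc (list_bits w))"
proof -
  have "bits (int (length w)) \<le> Suc (Suc (list_bits w))"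
  proof (rule bits_leI)
    have "length w < 2 ^ Suc (list_bits w)"
      using length_le_list_bits[of w] less_exp[of "Suc (list_bits w)"] by linarith
    then show "\<bar>int (length w)\<bar> < 2 ^ Suc (list_bits w)"
      by (metis abs_of_nat of_nat_less_iff of_nat_numeral of_nat_power)
  qed simp
  moreover have "bits (w ! nat (i - 1)) \<le> Suc (Suc (list_bits w))" if "1 \<le> i" "i \<le> int (length w)"
    using bits_le_list_bits[of "w ! nat (i - 1)" w] that by simp
  moreover have "bits 0 \<le> Suc (Suc (list_bits w))" by (simp add: bits_def floorlog_def)
  ultimately show ?thesis by (simp add: input_state_def)
qed

lemma input_state_nth: "k < length w \<Longrightarrow> input_state w ''in'' (int k + 1) = w ! k"
  by (simp add: input_state_def)

lemma list_bits_pairs: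
  "list_bits (concat (map (\<lambda>x. [f x, g x]) xs)) = (\<Sum>x\<leftarrow>xs. bits (f x) + bits (g x))"
  by (induction xs) (auto simp: list_bits_def)

text \<open>Each denominator is at most 2 to its bit length, and the exponents add up. This keeps
  the common multiple \<open>D\<close> of polynomial length.\<close>

lemma quotient_of_prod_le:
  "(\<Prod>j<dim_vec x. snd (quotient_of (x $ j))) \<le>
    2 ^ list_bits (concat (map (\<lambda>q. [fst (quotient_of q), snd (quotient_of q)]) (list_of_vec x)))"
proof -
  let ?q = "\<lambda>j. snd (quotient_of (x $ j))"
  have "(\<Prod>j<dim_vec x. ?q j) \<le> (\<Prod>j<dim_vec x. 2 ^ bits (?q j))"
  proof (intro prod_mono conjI)
    fix j
    show "0 \<le> ?q j" using quotient_of_denom_pos'[of "x $ j"] by simp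
    show "?q j \<le> 2 ^ bits (?q j)" using abs_le_power_bits[of "?q j"] by simp
  qed
  also have "\<dots> = 2 ^ (\<Sum>j<dim_vec x. bits (?q j))"
    by (simp add: power_sum)
  also have "\<dots> \<le> 2 ^ (\<Sum>q\<leftarrow>list_of_vec x. bits (fst (quotient_of q)) + bits (snd (quotient_of q)))"
    unfolding list_of_vec_map map_map comp_def interv_sum_list_conv_sum_set_nat atLeast0LessThan
    by (intro power_increasing sum_mono) (auto simp: atLeast0LessThan intro!: sum_mono)
  finally show ?thesis by (simp add: list_bits_pairs)
qed

lemma length_pairs: "length (concat (map (\<lambda>x. [f x, g x]) xs)) = 2 * length xs"
  by (induction xs) auto

lemma nth_pairs:
  assumes "j < length xs"
  shows "concat (map (\<lambda>x. [f x, g x]) xs) ! (2 * j) = f (xs ! j)"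
    "concat (map (\<lambda>x. [f x, g x]) xs) ! Suc (2 * j) = g (xs ! j)"
  using assms by (induction xs arbitrary: j) (auto simp: less_Suc_eq_0_disj)

section \<open>A fixed encoded instance\<close>

context
  fixes m n :: nat and A :: "nat mat" and d c :: "nat vec" and x :: "rat vec"
  assumes carrier: "A \<in> carrier_mat m n" "d \<in> carrier_vec m" "c \<in> carrier_vec n" "x \<in> carrier_vec n"
    and x_mem: "map_vec of_rat x \<in> lp_polytope A d"
begin

definition input_word :: "int list" where "input_word = encode_wi_sp (A, d, c, x)"

definition W :: nat where "W = list_bits input_word"

text \<open>Offsets of the blocks of the encoding. Positions count from 0, so the address in
  \<open>''in''\<close> is larger by one.\<close>

lemma encode_nth:
  "length (input_word) = 2 + m * n + m + n + 2 * n"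
  "input_word ! 1 = int n"
  "i < m \<Longrightarrow> j < n \<Longrightarrow> input_word ! (2 + (i * n + j)) = int (A $$ (i, j))"
  "i < m \<Longrightarrow> input_word ! (2 + m * n + i) = int (d $ i)"
  "j < n \<Longrightarrow> input_word ! (2 + m * n + m + n + 2 * j) = fst (quotient_of (x $ j))"
  "j < n \<Longrightarrow> input_word ! (2 + m * n + m + n + Suc (2 * j)) = snd (quotient_of (x $ j))"
proof -
  have dims: "dim_row A = m" "dim_col A = n" "dim_vec d = m" "dim_vec c = n" "dim_vec x = n"
    using carrier by auto
  let ?A = "concat (mat_to_list A)"
  have lA: "length ?A = m * n"
    by (simp add: mat_to_list_def dims length_concat comp_def sum_list_triv)
  have nA: "?A ! (i * n + j) = A $$ (i, j)" if "i < m" "j < n" for i j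
    unfolding mat_to_list_def dims
    by (subst nth_concat_uniform[where l = n]) (use that in auto)
  have less: "i * n + j < m * n" if "i < m" "j < n" for i j
    using that mult_le_mono1[of "Suc i" m n] by simp
  show "length (input_word) = 2 + m * n + m + n + 2 * n"
    using dims lA input_word_def by (simp add: length_pairs)
  show "input_word ! 1 = int n"
    using dims input_word_def by simp
  show "i < m \<Longrightarrow> j < n \<Longrightarrow> input_word ! (2 + (i * n + j)) = int (A $$ (i, j))"
    using less[of i j] nA[of i j] lA input_word_def by (simp add: nth_append)
  show "i < m \<Longrightarrow> input_word ! (2 + m * n + i) = int (d $ i)"
    using lA dims input_word_def by (simp add: nth_append list_of_vec_index)
  show "j < n \<Longrightarrow> input_word ! (2 + m * n + m + n + 2 * j) = fst (quotient_of (x $ j))"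
    using lA dims input_word_def by (simp add: nth_append nth_pairs list_of_vec_index)
  show "j < n \<Longrightarrow> input_word ! (2 + m * n + m + n + Suc (2 * j)) = snd (quotient_of (x $ j))"
    using lA dims input_word_def by (simp add: nth_append nth_pairs list_of_vec_index)
qed

lemma abs_encode_nth:
  assumes "k < length (input_word)"
  shows "\<bar>input_word ! k\<bar> \<le> 2 ^ W"
proof -
  have "bits (input_word ! k) \<le> W"
    unfolding W_def using assms by (intro bits_le_list_bits nth_mem)
  then have "(2 :: int) ^ bits (input_word ! k) \<le> 2 ^ W"
    by (intro power_increasing) auto
  with abs_le_power_bits show ?thesis by (rule order_trans)
qed

lemma W_ge: "n + m + 2 \<le> W"
  using length_le_list_bits[of "input_word"] encode_nth(1) by (simp add: W_def)

lemma x_bounds: "j < n \<Longrightarrow> 0 \<le> x $ j \<and> x $ j \<le> 1"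
  using x_mem carrier by (auto simp: lp_polytope_def)

lemma quotient_of_x:
  "j < n \<Longrightarrow> real_of_rat (x $ j) = fst (quotient_of (x $ j)) / snd (quotient_of (x $ j))"
  by (metis of_rat_divide of_rat_of_int_eq prod.collapse quotient_of_div)

text \<open>The input length \<open>W\<close> bounds each entry and the product of the denominators
  by \<open>2 ^ W\<close>; as it exceeds \<open>m\<close> and \<open>n\<close> as well,
  \<open>M = 2 ^ W\<close> meets all requirements.\<close>

lemma wi_data:
  "wi_data m n (input_state (input_word) ''in'') (\<lambda>i j. int (A $$ (i, j)))
    (\<lambda>i. int (d $ i)) (\<lambda>j. fst (quotient_of (x $ j))) (\<lambda>j. snd (quotient_of (x $ j)))
    (2 ^ W) (6 * W + 2)"
proof
    have inner: "i * n + j < m * n" if "i < m" "j < n" for i j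
    using that mult_le_mono1[of "Suc i" m n] by simp
  have read: "input_state input_word ''in'' z = input_word ! k" if "z = int k + 1" "k < length input_word" for z k
    using input_state_nth[of k input_word] that by simp
  show "input_state input_word ''in'' 2 = int n"
    using read[of 2 1] encode_nth(1,2) by simp
  show "input_state input_word ''in'' (3 + int i * int n + int j) = int (A $$ (i, j))" if "i < m" "j < n" for i j
    using read[of _ "2 + (i * n + j)"] encode_nth(1) encode_nth(3)[OF that] inner[OF that] by (simp add: add.assoc)
  show "input_state input_word ''in'' (3 + int i + int m * int n) = int (d $ i)" if "i < m" for i
    using read[of "3 + int i + int m * int n" "2 + m * n + i"] encode_nth(1) encode_nth(4)[OF that] that by simp
  show "input_state input_word ''in'' (3 + int m + (int m + 1) * int n + 2 * int j) = fst (quotient_of (x $ j))"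
    if "j < n" for j
    using read[of _ "2 + m * n + m + n + 2 * j"] encode_nth(1) encode_nth(5)[OF that] that
    by (simp add: algebra_simps)
  show "input_state input_word ''in'' (4 + int m + (int m + 1) * int n + 2 * int j) = snd (quotient_of (x $ j))"
    if "j < n" for j
    using read[of _ "2 + m * n + m + n + Suc (2 * j)"] encode_nth(1) encode_nth(6)[OF that] that
    by (simp add: algebra_simps)
  show "int (A $$ (i, j)) \<le> 2 ^ W" if "i < m" "j < n" for i j
    using abs_encode_nth[of "2 + (i * n + j)"] encode_nth(1) encode_nth(3)[OF that] inner[OF that] by (simp add: add.assoc)
  show "int (d $ i) \<le> 2 ^ W" if "i < m" for i
    using abs_encode_nth[of "2 + m * n + i"] encode_nth(1) encode_nth(4)[OF that] that by simp
  show pos: "0 < snd (quotient_of (x $ j))" for j by (rule quotient_of_denom_pos')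
  show "0 \<le> fst (quotient_of (x $ j))" "fst (quotient_of (x $ j)) \<le> snd (quotient_of (x $ j))"
    if "j < n" for j
    using x_bounds[OF that] quotient_of_x[OF that] pos[of j]
    by (simp_all flip: of_rat_less_eq[where 'a = real] add: zero_le_divide_iff divide_le_eq)
  show "(\<Prod>j<n. snd (quotient_of (x $ j))) \<le> 2 ^ W"
  proof -
    have "list_bits (concat (map (\<lambda>q. [fst (quotient_of q), snd (quotient_of q)]) (list_of_vec x))) \<le> W"
      unfolding W_def input_word_def encode_wi_sp.simps list_bits_append by simp 
    then have "(2 :: int) ^ list_bits (concat (map (\<lambda>q. [fst (quotient_of q), snd (quotient_of q)])
        (list_of_vec x))) \<le> 2 ^ W"
      by (intro power_increasing) auto
    with quotient_of_prod_le[of x] have "(\<Prod>j<dim_vec x. snd (quotient_of (x $ j))) \<le> 2 ^ W"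
      by (rule order_trans)
    then show ?thesis using carrier(4) by simp
  qed
  have "n + 1 \<le> W" "m \<le> W" using W_ge by auto
  moreover have "W \<le> 2 ^ W" using less_exp[of W] by simp
  ultimately have "n + 1 \<le> 2 ^ W" "m \<le> 2 ^ W" by linarith+
  then show "int n + 1 \<le> 2 ^ W" "int m \<le> 2 ^ W"
    by (metis of_nat_1 of_nat_add of_nat_le_iff of_nat_numeral of_nat_power)+
  show "(2 :: int) ^ m \<le> 2 ^ W" using W_ge by (intro power_increasing) auto
  have "(2 :: int) ^ 2 \<le> 2 ^ W" using W_ge by (intro power_increasing) auto
  then show "(4 :: int) \<le> 2 ^ W" by simp
  show "bits z \<le> 6 * W + 2" if "\<bar>z\<bar> \<le> (2 ^ W) ^ 6" for z
  proof (rule bits_leI)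
    have "(2 :: int) ^ (6 * W) < 2 ^ (6 * W + 1)" by simp
    moreover have "\<bar>z\<bar> \<le> 2 ^ (6 * W)"
      using that by (simp add: mult.commute flip: power_mult)
    ultimately show "\<bar>z\<bar> < 2 ^ (6 * W + 1)" by (rule le_less_trans[rotated])
  qed simp
qed auto

interpretation wi: wi_data m n "input_state input_word ''in''" "\<lambda>i j. int (A $$ (i, j))"
  "\<lambda>i. int (d $ i)" "\<lambda>j. fst (quotient_of (x $ j))" "\<lambda>j. snd (quotient_of (x $ j))"
  "2 ^ W" "6 * W + 2"
  by (rule wi_data)

section \<open>Correctness of the answer and the polynomial bound\<close>

lemma violated_wi_iff:
  "violated_wi (A, d, c, x) i P \<longleftrightarrow> i < m \<and> P \<subseteq> {..<n} \<and>
     (\<Sum>j\<in>P. real (A $$ (i, j))) \<le> real (d $ i) \<and>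
     \<not> (\<Sum>j\<in>P. real (A $$ (i, j)) * real_of_rat (x $ j)) +
       (\<Sum>j\<in>{..<n} - P. max (real (A $$ (i, j)) -
          (real (d $ i) - (\<Sum>j\<in>P. real (A $$ (i, j))))) 0 * real_of_rat (x $ j))
       \<le> (\<Sum>j\<in>P. real (A $$ (i, j)))"
proof (cases "i < m \<and> P \<subseteq> {..<n}")
  case True
  let ?a = "map_vec real (row A i)" and ?x = "map_vec real_of_rat x"
  have a: "?a $ j = real (A $$ (i, j))" "?x $ j = real_of_rat (x $ j)" if "j < n" for j
    using that True carrier by auto
  have "(\<Sum>j\<in>P. ?a $ j) = (\<Sum>j\<in>P. real (A $$ (i, j)))"
    "(\<Sum>j\<in>P. ?a $ j * ?x $ j) = (\<Sum>j\<in>P. real (A $$ (i, j)) * real_of_rat (x $ j))"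
    "(\<Sum>j\<in>{..<n} - P. max (?a $ j - r) 0 * ?x $ j) =
      (\<Sum>j\<in>{..<n} - P. max (real (A $$ (i, j)) - r) 0 * real_of_rat (x $ j))" for r
    using True by (intro sum.cong refl; auto simp: a)+
  moreover have "dim_vec ?a = n" "dim_row A = m" using carrier by auto
  ultimately show ?thesis
    using True by (simp add: is_pack_def weight_inequality_def residual_capacity_def atLeast0LessThan)
next
  case False
  then show ?thesis using carrier by (auto simp: is_pack_def)
qed

lemma quotient_of_x_sums:
  assumes "Q \<subseteq> {..<n}"
  shows "(\<Sum>j\<in>Q. f j * (real_of_int (fst (quotient_of (x $ j))) / real_of_int (snd (quotient_of (x $ j))))) =
    (\<Sum>j\<in>Q. f j * real_of_rat (x $ j))"
  using assms by (intro sum.cong) (auto simp: quotient_of_x)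

lemma hit_iff_violated_wi:
  assumes "i < m"
  shows "wi.hit i k \<longleftrightarrow> violated_wi (A, d, c, x) i (wi.cand k)"
proof -
  have "wi.cand k \<subseteq> {..<n}" by (auto simp: wi.cand_def)
  then show ?thesis
    using assms quotient_of_x_sums unfolding wi.hit_iff[OF assms] violated_wi_iff by simp
qed

lemma row_feasible:
  assumes "i < m"
  shows "(\<Sum>j<n. real (A $$ (i, j)) * real_of_rat (x $ j)) \<le> real (d $ i)"
proof -
  have "(map_mat real A *\<^sub>v map_vec real_of_rat x) $ i \<le> map_vec real d $ i"
    using x_mem carrier assms by (auto simp: lp_polytope_def less_eq_vec_def)
  moreover have "(map_mat real A *\<^sub>v map_vec real_of_rat x) $ i =
      (\<Sum>j<n. real (A $$ (i, j)) * real_of_rat (x $ j))"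
    using assms carrier by (auto simp: scalar_prod_def atLeast0LessThan intro!: sum.cong)
  ultimately show ?thesis using assms carrier by simp
qed

lemma frac_iff:
  assumes "j < n"
  shows "wi.frac j \<longleftrightarrow> 0 < real_of_rat (x $ j) \<and> real_of_rat (x $ j) < 1"
  using quotient_of_x[OF assms] quotient_of_denom_pos'[of "x $ j"]
  unfolding wi.frac_def by (simp add: zero_less_divide_iff divide_less_eq)

text \<open>Extremality of \<open>x\<close> enters here, to bound the number of fractional variables
  by \<open>m\<close>.\<close>

lemma violated_wi_hit:
  assumes "extreme_point (map_vec of_rat x) (lp_polytope A d)" "violated_wi (A, d, c, x) i P"
  shows "\<exists>k < 2 ^ m. wi.hit i k"
proof -
  have i: "i < m" and P: "P \<subseteq> {..<n}" using assms(2) unfolding violated_wi_iff by auto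
  have "{j. j < n \<and> wi.frac j} = {j. j < n \<and> 0 < map_vec real_of_rat x $ j \<and> map_vec real_of_rat x $ j < 1}"
    using frac_iff carrier by auto
  then have few: "card {j. j < n \<and> wi.frac j} \<le> m"
    using extreme_point_card_fractional[OF carrier(1) assms(1)] by simp
  show ?thesis
    using assms(2) row_feasible[OF i] few P
    unfolding violated_wi_iff by (intro wi.hit_exists[OF i, of P]) (simp_all add: quotient_of_x_sums del: times_divide_eq_right)
qed

text \<open>If some inequality is violated, a tested pair is a hit, so the first disjunct of
  \<open>settled\<close> fails. If none is, no pair is a hit, so the output has length 0.\<close>

lemma settled_answer:
  assumes ext: "extreme_point (map_vec of_rat x) (lp_polytope A d)"
    and s: "wi.settled ({..<m} \<times> {..<2 ^ m}) s"
  shows "wi_sp_answer (A, d, c, x) (output_word s)" "length (output_word s) \<le> n + 1"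
proof -
  have no: "s ''out'' 0 = 0 \<Longrightarrow> output_word s = []" by (simp add: output_word_def)
  show "wi_sp_answer (A, d, c, x) (output_word s)"
  proof (cases "\<exists>i P. violated_wi (A, d, c, x) i P")
    case True
    then obtain i P where v: "violated_wi (A, d, c, x) i P" by blast
    then have "i < m" unfolding violated_wi_iff by blast
    moreover obtain k where "k < 2 ^ m" "wi.hit i k" using violated_wi_hit[OF ext v] by blast
    ultimately obtain i k where ik: "i < m" "wi.hit i k" "s ''out'' 0 = int n + 1" "s ''out'' 1 = int i"
        "\<And>l. l < n \<Longrightarrow> s ''out'' (2 + int l) = of_bool (l \<in> wi.cand k)"
      using s unfolding wi.settled_def by force
    have "output_word s = int i # map (\<lambda>j. if j \<in> wi.cand k then 1 else 0) [0..<dim_col A]"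
    proof (rule nth_equalityI)
      show "length (output_word s) = length (int i # map (\<lambda>j. if j \<in> wi.cand k then 1 else 0) [0..<dim_col A])"
        using ik(3) carrier by (simp add: output_word_def)
      fix l assume "l < length (output_word s)"
      then have l: "l < n + 1" using ik(3) by (simp add: output_word_def)
      \<comment> \<open>Entry \<open>l\<close> lies in cell \<open>l + 1\<close>: position 0 is the
        row, and position \<open>l > 0\<close> concerns variable \<open>l - 1\<close>.\<close>
      then have "output_word s ! l = s ''out'' (1 + int l)"
        using ik(3) by (simp add: output_word_def nth_upto)
      then show "output_word s ! l =
          (int i # map (\<lambda>j. if j \<in> wi.cand k then 1 else 0) [0..<dim_col A]) ! l"
        using l ik(4) ik(5)[of "l - 1"] carrier by (cases l) auto
    qed
    moreover have "violated_wi (A, d, c, x) i (wi.cand k)"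
      using ik hit_iff_violated_wi by blast
    ultimately show ?thesis using True by auto
  next
    case False
    then have "\<not> wi.hit i k" if "i < m" for i k
      using hit_iff_violated_wi that by blast
    then have "s ''out'' 0 = 0" using s unfolding wi.settled_def by blast
    then show ?thesis using no False by simp
  qed
  show "length (output_word s) \<le> n + 1"
    using s unfolding wi.settled_def by (auto simp: output_word_def)
qed

text \<open>The factor \<open>[:2, 6:]\<close> evaluates to the cell bound \<open>6 * W + 2\<close>.
  Multiplied by it, \<open>cost_poly\<close> pays for the run and \<open>[:1, 1:]\<close> for the at
  most \<open>n + 1\<close> output entries.\<close>

lemma separate_correct:
  assumes "extreme_point (map_vec of_rat x) (lp_polytope A d)"
  shows "\<exists>t s. exec (separate m) (input_state input_word) t s \<and>
    t + list_bits (output_word s) \<le> poly ((cost_poly (separate m) + [:1, 1:]) * [:2, 6:]) W \<and>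
    wi_sp_answer (A, d, c, x) (output_word s)"
proof -
  have "small (6 * W + 2) (input_state input_word)"
    unfolding small_def
    using bits_input_state[of input_word] by (fastforce simp: W_def intro: order_trans)
  then obtain t s where ts: "exec (separate m) (input_state input_word) t s"
      "t \<le> poly (cost_poly (separate m)) n * (6 * W + 2)" "small (6 * W + 2) s"
      "wi.settled ({..<m} \<times> {..<2 ^ m}) s"
    using tripleE[OF wi.triple_separate, of "input_state input_word"]
    by (auto simp: input_state_def)
  have "list_bits (output_word s) \<le> length (output_word s) * (6 * W + 2)"
    using ts(3) by (intro list_bits_le) (auto simp: output_word_def small_def)
  also have "\<dots> \<le> (W + 1) * (6 * W + 2)"
    using settled_answer(2)[OF assms ts(4)] W_ge by (intro mult_right_mono) auto
  finally have "list_bits (output_word s) \<le> (W + 1) * (6 * W + 2)" .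
  moreover have "poly (cost_poly (separate m)) n * (6 * W + 2) \<le>
      poly (cost_poly (separate m)) W * (6 * W + 2)"
    using W_ge by (intro mult_right_mono poly_mono_nat) auto
  ultimately have "t + list_bits (output_word s) \<le>
      poly ((cost_poly (separate m) + [:1, 1:]) * [:2, 6:]) W"
    using ts(2) by (simp add: algebra_simps)
  with ts(1) settled_answer(1)[OF assms ts(4)] show ?thesis by blast
qed

end

theorem corollary4:
  fixes m :: nat
  shows "poly_time_solvable
    {(A, d, c, x) \<in> wi_sp_inputs m. extreme_point (map_vec of_rat x) (lp_polytope A d)}
    encode_wi_sp wi_sp_answer"
  unfolding poly_time_solvable_def
proof (rule exI, rule exI, rule ballI)
  fix y :: wi_sp
  assume y: "y \<in> {(A, d, c, x) \<in> wi_sp_inputs m. extreme_point (map_vec of_rat x) (lp_polytope A d)}"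
  obtain A d c x where y_eq: "y = (A, d, c, x)" by (cases y)
  with y obtain n where carrier: "A \<in> carrier_mat m n" "d \<in> carrier_vec m" "c \<in> carrier_vec n"
      "x \<in> carrier_vec n" and mem: "map_vec of_rat x \<in> lp_polytope A d"
    and ext: "extreme_point (map_vec of_rat x) (lp_polytope A d)"
    by (auto simp: wi_sp_inputs_def lp_optimal_def)
  \<comment> \<open>This fixes the program and the polynomial left open above; both depend on
    \<open>m\<close> only.\<close>
  show "\<exists>t s. exec (separate m) (input_state (encode_wi_sp y)) t s \<and>
      t + list_bits (output_word s) \<le>
        poly ((cost_poly (separate m) + [:1, 1:]) * [:2, 6:]) (list_bits (encode_wi_sp y)) \<and>
      wi_sp_answer y (output_word s)"
    using separate_correct[OF carrier mem ext]
    unfolding y_eq input_word_def[OF carrier mem] W_def[OF carrier mem] .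
qed

end
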